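(* Let $a,b\in\mathbb{C}$ with $0\le \mathrm{Re}(a)<1$, let $\mathfrak g=\mathcal{HV}(a,b;1)$ and $\mathfrak h=\mathbb{C}L_{0,0}\subset\mathfrak g$. Then any free $\mathcal{U}(\mathfrak h)$-module of rank one over $\mathfrak g$ is isomorphic, as a $\mathfrak g$-module, to $\Omega_{\mathfrak g}(\lambda,\alpha,\beta,\gamma)$ for some $\lambda\in\mathbb{C}^*$ and $\alpha,\beta,\gamma\in\mathbb{C}$, where $\Omega_{\mathfrak g}(\lambda,\alpha,\beta,\gamma)=\mathbb{C}[t]$ as a vector space, with actions, for $i\in\mathbb{Z}$, $m\in\mathbb{Z}_+$, $f(t)\in\mathbb{C}[t]$, $$L_{i,m}\cdot f(t)=\sum_{s=0}^{m}\binom{m}{s}\lambda^i\left(\beta^{m-s}(t-i\alpha)+(m-s)\alpha\beta^{m-s-1}\right)f^{(s)}(t-i),$$ and $$H_{i,m}\cdot f(t)=\begin{cases}\displaystyle\sum_{s=0}^{m}\binom{m}{s}\lambda^i\beta^{m-s}\gamma f^{(s)}(t-a-i), & b=0,\\ \displaystyle\sum_{s=0}^{m}\sum_{\ell=0}^{m-s}\frac{(m-s)!}{(m-s-\ell)!}\binom{m}{s}\frac{a\lambda^i\beta^{m-s-\ell}\gamma}{(a+i)^{\ell+1}}f^{(s)}(t-a-i), & b=1,\ a\neq0,\\ 0, & \text{otherwise}.\end{cases}$$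
   Context: $\mathbb{Z}_+$ is the set of nonnegative integers and $\mathbb{C}^*=\mathbb{C}\setminus\{0\}$. $\mathcal{HV}(a,b;1)$ is the complex Lie algebra with basis $\{L_{i,m},H_{j,n}\mid i,j\in\mathbb{Z},\,m,n\in\mathbb{Z}_+\}$ and brackets $[L_{i,m},L_{j,n}]=(j-i)L_{i+j,m+n}-(n-m)L_{i+j,m+n-1}$, $[L_{i,m},H_{j,n}]=(a+j+bi)H_{i+j,m+n}-(n+bm)H_{i+j,m+n-1}$, $[H_{i,m},H_{j,n}]=0$ (when $m=n=0$ the terms with second index $-1$ have coefficient $0$ and are omitted). A free $\mathcal{U}(\mathfrak h)$-module of rank one over $\mathfrak g$ is a $\mathfrak g$-module whose restriction to $\mathcal{U}(\mathfrak h)=\mathbb{C}[L_{0,0}]$ is free of rank one. $f^{(s)}$ is the $s$-th derivative of $f$, and $f^{(s)}(t-c)$ is $f^{(s)}$ evaluated at $t-c$. Conventions: $0^0=1$, and the term $(m-s)\alpha\beta^{m-s-1}$ is $0$ when $s=m$ (also for $\beta=0$). *)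

theory Defs
  imports Complex_Main "HOL-Library.Poly_Mapping" "HOL-Computational_Algebra.Polynomial"
begin

section \<open>Lie algebras, their modules, free modules of rank one\<close>

locale lie_algebra = vector_space scale
  for scale :: "'k::field \<Rightarrow> 'g::ab_group_add \<Rightarrow> 'g" +
  fixes bracket :: "'g \<Rightarrow> 'g \<Rightarrow> 'g"
  assumes bracket_linear_left: "Vector_Spaces.linear scale scale (\<lambda>x. bracket x y)"
    and bracket_linear_right: "Vector_Spaces.linear scale scale (\<lambda>y. bracket x y)"
    and bracket_alternating: "bracket x x = 0"
    and jacobi:
      "bracket x (bracket y z) + bracket y (bracket z x) + bracket z (bracket x y) = 0"

locale lie_module = lie_algebra scale bracket + V: vector_space scaleV
  for scale :: "'k::field \<Rightarrow> 'g::ab_group_add \<Rightarrow> 'g"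
    and bracket :: "'g \<Rightarrow> 'g \<Rightarrow> 'g"
    and scaleV :: "'k \<Rightarrow> 'v::ab_group_add \<Rightarrow> 'v" +
  fixes act :: "'g \<Rightarrow> 'v \<Rightarrow> 'v"
  assumes act_linear_left: "Vector_Spaces.linear scale scaleV (\<lambda>x. act x v)"
    and act_linear_right: "Vector_Spaces.linear scaleV scaleV (act x)"
    and act_bracket: "act (bracket x y) v = act x (act y v) - act y (act x v)"

locale lie_module_isomorphism =
  V: lie_module scale bracket scaleV actV +
  W: lie_module scale bracket scaleW actW +
  Vector_Spaces.linear scaleV scaleW \<phi>
  for scale :: "'k::field \<Rightarrow> 'g::ab_group_add \<Rightarrow> 'g"
    and bracket :: "'g \<Rightarrow> 'g \<Rightarrow> 'g"
    and scaleV :: "'k \<Rightarrow> 'v::ab_group_add \<Rightarrow> 'v"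
    and actV :: "'g \<Rightarrow> 'v \<Rightarrow> 'v"
    and scaleW :: "'k \<Rightarrow> 'w::ab_group_add \<Rightarrow> 'w"
    and actW :: "'g \<Rightarrow> 'w \<Rightarrow> 'w"
    and \<phi> :: "'v \<Rightarrow> 'w" +
  assumes bij: "bij \<phi>"
    and equivariant: "\<phi> (actV x v) = actW x (\<phi> v)"

definition lie_module_isomorphic ::
  "('k::field \<Rightarrow> 'g::ab_group_add \<Rightarrow> 'g) \<Rightarrow> ('g \<Rightarrow> 'g \<Rightarrow> 'g) \<Rightarrow>
   ('k \<Rightarrow> 'v::ab_group_add \<Rightarrow> 'v) \<Rightarrow> ('g \<Rightarrow> 'v \<Rightarrow> 'v) \<Rightarrow>
   ('k \<Rightarrow> 'w::ab_group_add \<Rightarrow> 'w) \<Rightarrow> ('g \<Rightarrow> 'w \<Rightarrow> 'w) \<Rightarrow> bool" where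
  "lie_module_isomorphic scale bracket scaleV actV scaleW actW \<longleftrightarrow>
     (\<exists>\<phi>. lie_module_isomorphism scale bracket scaleV actV scaleW actW \<phi>)"

definition free_of_rank_one :: "('r::comm_ring_1 \<Rightarrow> 'v::ab_group_add \<Rightarrow> 'v) \<Rightarrow> bool" where
  "free_of_rank_one scale \<longleftrightarrow>
     module scale \<and>
     (\<exists>w. \<not> module.dependent scale {w} \<and> module.span scale {w} = UNIV)"

text \<open>The action of a polynomial ring on a vector space in which the indeterminate acts as \<open>T\<close>.
  If \<open>T\<close> is the action of a Lie algebra element \<open>x\<close>, this is the restriction of the module to the
  enveloping algebra of the line spanned by \<open>x\<close>, since that algebra is the polynomial ring in \<open>x\<close>.\<close>

definition poly_action ::
  "('k::comm_ring_1 \<Rightarrow> 'v::ab_group_add \<Rightarrow> 'v) \<Rightarrow> ('v \<Rightarrow> 'v) \<Rightarrow> 'k poly \<Rightarrow> 'v \<Rightarrow> 'v" where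
  "poly_action scale T p v = (\<Sum>n\<le>degree p. scale (coeff p n) ((T ^^ n) v))"

section \<open>The Lie algebra \<open>HV(a,b;1)\<close>\<close>

datatype hv_basis = L int nat | H int nat

text \<open>The vector space with basis \<open>hv_basis\<close>: finitely supported coefficient functions.\<close>

type_synonym hv = "hv_basis \<Rightarrow>\<^sub>0 complex"

definition hv_scale :: "complex \<Rightarrow> hv \<Rightarrow> hv" where
  "hv_scale c x = Poly_Mapping.map ((*) c) x"

definition lin_ext ::
  "(complex \<Rightarrow> 'v::ab_group_add \<Rightarrow> 'v) \<Rightarrow> (hv_basis \<Rightarrow> 'v) \<Rightarrow> hv \<Rightarrow> 'v" where
  "lin_ext scale f x = (\<Sum>p\<in>Poly_Mapping.keys x. scale (Poly_Mapping.lookup x p) (f p))"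

text \<open>Here \<open>Poly_Mapping.single p c\<close> is \<open>c\<close> times the basis vector \<open>p\<close>. For \<open>m = n = 0\<close> the truncated
  subtraction \<open>m + n - 1\<close> is harmless: the term in question has coefficient \<open>0\<close>.\<close>

fun hv_bracket_basis :: "complex \<Rightarrow> complex \<Rightarrow> hv_basis \<Rightarrow> hv_basis \<Rightarrow> hv" where
  "hv_bracket_basis a b (L i m) (L j n) =
     Poly_Mapping.single (L (i + j) (m + n)) (of_int j - of_int i)
     - Poly_Mapping.single (L (i + j) (m + n - 1)) (of_nat n - of_nat m)"
| "hv_bracket_basis a b (L i m) (H j n) =
     Poly_Mapping.single (H (i + j) (m + n)) (a + of_int j + b * of_int i)
     - Poly_Mapping.single (H (i + j) (m + n - 1)) (of_nat n + b * of_nat m)"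
| "hv_bracket_basis a b (H j n) (L i m) =
     - (Poly_Mapping.single (H (i + j) (m + n)) (a + of_int j + b * of_int i)
        - Poly_Mapping.single (H (i + j) (m + n - 1)) (of_nat n + b * of_nat m))"
| "hv_bracket_basis a b (H i m) (H j n) = 0"

definition hv_bracket :: "complex \<Rightarrow> complex \<Rightarrow> hv \<Rightarrow> hv \<Rightarrow> hv" where
  "hv_bracket a b x y =
     lin_ext hv_scale (\<lambda>p. lin_ext hv_scale (\<lambda>q. hv_bracket_basis a b p q) y) x"

section \<open>The modules \<open>\<Omega>(\<lambda>,\<alpha>,\<beta>,\<gamma>)\<close>\<close>

text \<open>\<open>deriv_shift s c f\<close> is \<open>f\<^sup>(\<^sup>s\<^sup>)(t - c)\<close>.\<close>

definition deriv_shift :: "nat \<Rightarrow> complex \<Rightarrow> complex poly \<Rightarrow> complex poly" where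
  "deriv_shift s c f = pcompose ((pderiv ^^ s) f) [:- c, 1:]"

fun omega_basis ::
  "complex \<Rightarrow> complex \<Rightarrow> complex \<Rightarrow> complex \<Rightarrow> complex \<Rightarrow> complex \<Rightarrow>
   hv_basis \<Rightarrow> complex poly \<Rightarrow> complex poly" where
  "omega_basis a b lam \<alpha> \<beta> \<gamma> (L i m) f =
     (\<Sum>s = 0..m. smult (of_nat (m choose s) * lam powi i)
        ((smult (\<beta> ^ (m - s)) [:- (of_int i * \<alpha>), 1:]
          + [:of_nat (m - s) * \<alpha> * \<beta> ^ (m - s - 1):])
         * deriv_shift s (of_int i) f))"
| "omega_basis a b lam \<alpha> \<beta> \<gamma> (H i m) f =
     (if b = 0 then
        (\<Sum>s = 0..m. smult (of_nat (m choose s) * lam powi i * \<beta> ^ (m - s) * \<gamma>)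
           (deriv_shift s (a + of_int i) f))
      else if b = 1 \<and> a \<noteq> 0 then
        (\<Sum>s = 0..m. \<Sum>l = 0..m - s.
           smult (fact (m - s) / fact (m - s - l) * of_nat (m choose s)
                  * (a * lam powi i * \<beta> ^ (m - s - l) * \<gamma> / (a + of_int i) ^ (l + 1)))
             (deriv_shift s (a + of_int i) f))
      else 0)"

definition omega ::
  "complex \<Rightarrow> complex \<Rightarrow> complex \<Rightarrow> complex \<Rightarrow> complex \<Rightarrow> complex \<Rightarrow>
   hv \<Rightarrow> complex poly \<Rightarrow> complex poly" where
  "omega a b lam \<alpha> \<beta> \<gamma> x f = lin_ext smult (\<lambda>p. omega_basis a b lam \<alpha> \<beta> \<gamma> p f) x"

section \<open>\<open>HV(a,b;1)\<close> is a Lie algebra\<close>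

lemma lookup_hv_scale [simp]:
  "Poly_Mapping.lookup (hv_scale c x) p = c * Poly_Mapping.lookup x p"
  by (auto simp: hv_scale_def Poly_Mapping.map.rep_eq when_def)

lemma vector_space_hv_scale: "vector_space hv_scale"
  by unfold_locales
    (auto intro!: poly_mapping_eqI simp: lookup_add algebra_simps)

interpretation hv: vector_space hv_scale
  by (rule vector_space_hv_scale)

lemma lin_ext_superset:
  assumes "vector_space scale" "finite A" "Poly_Mapping.keys x \<subseteq> A"
  shows "lin_ext scale f x = (\<Sum>p\<in>A. scale (Poly_Mapping.lookup x p) (f p))"
proof -
  interpret vector_space scale by fact
  show ?thesis
    unfolding lin_ext_def using assms(2,3)
    by (intro sum.mono_neutral_left) (auto simp: in_keys_iff)
qed

lemma linear_lin_ext: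
  assumes "vector_space scale"
  shows "Vector_Spaces.linear hv_scale scale (lin_ext scale f)"
proof -
  interpret V: vector_space scale by fact
  have add: "lin_ext scale f (x + y) = lin_ext scale f x + lin_ext scale f y" for x y
  proof -
    let ?A = "Poly_Mapping.keys x \<union> Poly_Mapping.keys y"
    note * = lin_ext_superset[OF assms, of ?A]
    have "lin_ext scale f (x + y) = (\<Sum>p\<in>?A. scale (Poly_Mapping.lookup (x + y) p) (f p))"
      by (intro *) (auto simp: Poly_Mapping.keys_add)
    also have "\<dots> = lin_ext scale f x + lin_ext scale f y"
      by (subst (1 2) *) (auto simp: lookup_add V.scale_left_distrib sum.distrib)
    finally show ?thesis .
  qed
  have scl: "lin_ext scale f (hv_scale c x) = scale c (lin_ext scale f x)" for c x
  proof -
    have "lin_ext scale f (hv_scale c x)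
        = (\<Sum>p\<in>Poly_Mapping.keys x. scale (Poly_Mapping.lookup (hv_scale c x) p) (f p))"
      by (rule lin_ext_superset[OF assms]) (auto simp: in_keys_iff)
    also have "\<dots> = scale c (lin_ext scale f x)"
      by (simp add: lin_ext_def V.scale_sum_right)
    finally show ?thesis .
  qed
  show ?thesis
    by unfold_locales (auto simp: add scl)
qed

lemma lin_ext_single:
  assumes "vector_space scale"
  shows "lin_ext scale f (Poly_Mapping.single p c) = scale c (f p)"
proof -
  interpret V: vector_space scale by fact
  show ?thesis by (auto simp: lin_ext_def)
qed

lemma linear_lin_ext_arg:
  assumes "vector_space scale" "\<And>p. Vector_Spaces.linear s scale (\<lambda>y. f p y)"
  shows "Vector_Spaces.linear s scale (\<lambda>y. lin_ext scale (\<lambda>p. f p y) x)"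
proof -
  interpret V: vector_space scale by fact
  interpret F: Vector_Spaces.linear s scale "\<lambda>y. f undefined y" by (rule assms)
  interpret P: vector_space_pair s scale by unfold_locales
  show ?thesis unfolding lin_ext_def
    by (intro P.linear_compose_sum ballI P.linear_compose_scale_right assms)
qed

lemma linear_hv_bracket_left: "Vector_Spaces.linear hv_scale hv_scale (\<lambda>x. hv_bracket a b x y)"
  unfolding hv_bracket_def by (rule linear_lin_ext[OF vector_space_hv_scale])

lemma linear_hv_bracket_right: "Vector_Spaces.linear hv_scale hv_scale (hv_bracket a b x)"
  unfolding hv_bracket_def
  by (intro linear_lin_ext_arg linear_lin_ext vector_space_hv_scale)

lemma hv_bracket_single:
  "hv_bracket a b (Poly_Mapping.single p c) (Poly_Mapping.single q d)
   = hv_scale (c * d) (hv_bracket_basis a b p q)"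
  by (simp add: hv_bracket_def lin_ext_single[OF vector_space_hv_scale])

lemma hv_induct [case_names zero single add]:
  fixes P :: "hv \<Rightarrow> bool"
  assumes "P 0" "\<And>p c. P (Poly_Mapping.single p c)" "\<And>x y. P x \<Longrightarrow> P y \<Longrightarrow> P (x + y)"
  shows "P x"
proof -
  have "x = (\<Sum>p\<in>Poly_Mapping.keys x. Poly_Mapping.single p (Poly_Mapping.lookup x p))"
    by (intro poly_mapping_eqI)
      (auto simp: lookup_sum lookup_single when_def in_keys_iff)
  moreover have "P (\<Sum>p\<in>A. Poly_Mapping.single p (Poly_Mapping.lookup x p))" for A
    by (induction A rule: infinite_finite_induct) (auto intro: assms)
  ultimately show ?thesis by metis
qed

lemma hv_bracket_add_left: "hv_bracket a b (x + y) z = hv_bracket a b x z + hv_bracket a b y z"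
  and hv_bracket_add_right: "hv_bracket a b z (x + y) = hv_bracket a b z x + hv_bracket a b z y"
  and hv_bracket_diff_right: "hv_bracket a b z (x - y) = hv_bracket a b z x - hv_bracket a b z y"
  and hv_bracket_minus_right: "hv_bracket a b z (- x) = - hv_bracket a b z x"
  and hv_bracket_scale_left: "hv_bracket a b (hv_scale c x) z = hv_scale c (hv_bracket a b x z)"
  and hv_bracket_scale_right: "hv_bracket a b z (hv_scale c x) = hv_scale c (hv_bracket a b z x)"
  and hv_bracket_zero_left: "hv_bracket a b 0 z = 0"
  and hv_bracket_zero_right: "hv_bracket a b z 0 = 0"
proof -
  interpret l: Vector_Spaces.linear hv_scale hv_scale "\<lambda>x. hv_bracket a b x z"
    by (rule linear_hv_bracket_left)
  interpret r: Vector_Spaces.linear hv_scale hv_scale "hv_bracket a b z"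
    by (rule linear_hv_bracket_right)
  show "hv_bracket a b (x + y) z = hv_bracket a b x z + hv_bracket a b y z" by (rule l.add)
  show "hv_bracket a b z (x + y) = hv_bracket a b z x + hv_bracket a b z y" by (rule r.add)
  show "hv_bracket a b z (x - y) = hv_bracket a b z x - hv_bracket a b z y" by (rule r.diff)
  show "hv_bracket a b z (- x) = - hv_bracket a b z x" by (rule r.neg)
  show "hv_bracket a b (hv_scale c x) z = hv_scale c (hv_bracket a b x z)" by (rule l.scale)
  show "hv_bracket a b z (hv_scale c x) = hv_scale c (hv_bracket a b z x)" by (rule r.scale)
  show "hv_bracket a b 0 z = 0" by (rule l.zero)
  show "hv_bracket a b z 0 = 0" by (rule r.zero)
qed

lemma hv_bracket_basis_swap: "hv_bracket_basis a b q p = - hv_bracket_basis a b p q"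
  by (cases p; cases q)
    (auto intro!: poly_mapping_eqI simp: lookup_single lookup_minus when_def add.commute)

lemma hv_bracket_swap: "hv_bracket a b y x = - hv_bracket a b x y"
proof (induction x rule: hv_induct)
  case (single p c)
  show ?case
  proof (induction y rule: hv_induct)
    case (single q d)
    show ?case
      by (simp add: hv_bracket_single hv_bracket_basis_swap[of a b q p] mult.commute)
  qed (simp_all add: hv_bracket_add_left hv_bracket_add_right hv_bracket_zero_left
         hv_bracket_zero_right)
qed (simp_all add: hv_bracket_add_left hv_bracket_add_right hv_bracket_zero_left
       hv_bracket_zero_right)

abbreviation hv_jacobiator :: "complex \<Rightarrow> complex \<Rightarrow> hv \<Rightarrow> hv \<Rightarrow> hv \<Rightarrow> hv" where
  "hv_jacobiator a b x y z \<equiv>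
     hv_bracket a b x (hv_bracket a b y z) + hv_bracket a b y (hv_bracket a b z x)
     + hv_bracket a b z (hv_bracket a b x y)"

abbreviation hv_e :: "hv_basis \<Rightarrow> hv" where "hv_e p \<equiv> Poly_Mapping.single p 1"

lemma hv_jacobi_LLL: "hv_jacobiator a b (hv_e (L i m)) (hv_e (L j n)) (hv_e (L k r)) = 0"
  by (cases m; cases n; cases r;
      simp add: hv_bracket_single hv_bracket_diff_right;
      intro poly_mapping_eqI;
      auto simp: lookup_add lookup_minus lookup_single when_def algebra_simps)

lemma hv_jacobi_LLH: "hv_jacobiator a b (hv_e (L i m)) (hv_e (L j n)) (hv_e (H k r)) = 0"
  by (cases m; cases n; cases r;
      simp add: hv_bracket_single hv_bracket_diff_right hv_bracket_minus_right;
      intro poly_mapping_eqI;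
      auto simp: lookup_add lookup_minus lookup_single when_def algebra_simps)

lemma hv_jacobi_HH: "hv_jacobiator a b (hv_e p) (hv_e (H j n)) (hv_e (H k r)) = 0"
  by (cases p) (simp_all add: hv_bracket_single hv_bracket_diff_right hv_bracket_minus_right
      hv_bracket_zero_right)

lemma hv_jacobi_basis: "hv_jacobiator a b (hv_e p) (hv_e q) (hv_e u) = 0"
proof -
  have rot: "hv_jacobiator a b x y z = hv_jacobiator a b y z x" for x y z
    by (simp add: add_ac)
  show ?thesis
  proof (cases p)
    case p: (L i m)
    show ?thesis
    proof (cases q)
      case q: (L j n)
      show ?thesis
      proof (cases u)
        case (L k r) then show ?thesis unfolding p q by (simp only: hv_jacobi_LLL)
      next
        case (H k r) then show ?thesis unfolding p q by (simp only: hv_jacobi_LLH)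
      qed
    next
      case q: (H j n)
      show ?thesis
      proof (cases u)
        case (L k r)
        then show ?thesis unfolding p q
          by (subst rot, subst rot) (simp only: hv_jacobi_LLH)
      next
        case (H k r) then show ?thesis unfolding p q by (simp only: hv_jacobi_HH)
      qed
    qed
  next
    case p: (H i m)
    show ?thesis
    proof (cases q)
      case q: (L j n)
      show ?thesis
      proof (cases u)
        case (L k r)
        then show ?thesis unfolding p q by (subst rot) (simp only: hv_jacobi_LLH)
      next
        case (H k r)
        then show ?thesis unfolding p q by (subst rot) (simp only: hv_jacobi_HH)
      qed
    next
      case q: (H j n)
      show ?thesis unfolding p q by (subst rot, subst rot) (simp only: hv_jacobi_HH)
    qed
  qed
qed

lemma hv_jacobi: "hv_jacobiator a b x y z = 0"
proof -
  note lin = hv_bracket_add_left hv_bracket_add_right hv_bracket_zero_left hv_bracket_zero_right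
  have sgl: "Poly_Mapping.single p c = hv_scale c (hv_e p)" for p c
    by (intro poly_mapping_eqI) (simp add: lookup_single when_def)
  have ja: "hv_jacobiator a b (x + x') y z = hv_jacobiator a b x y z + hv_jacobiator a b x' y z"
    "hv_jacobiator a b x (y + y') z = hv_jacobiator a b x y z + hv_jacobiator a b x y' z"
    "hv_jacobiator a b x y (z + z') = hv_jacobiator a b x y z + hv_jacobiator a b x y z'"
    for x x' y y' z z' by (simp_all add: lin)
  show ?thesis
  proof (induction x rule: hv_induct)
    case zero show ?case by (simp add: lin)
  next
    case (add x x') then show ?case by (simp only: ja add_0_right)
  next
    case (single p c)
    show ?case
    proof (induction y rule: hv_induct)
      case zero show ?case by (simp add: lin)
    next
      case (add y y') then show ?case by (simp only: ja add_0_right)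
    next
      case (single q d)
      show ?case
      proof (induction z rule: hv_induct)
        case zero show ?case by (simp add: lin)
      next
        case (add z z') then show ?case by (simp only: ja add_0_right)
      next
        case (single u e)
        have "hv_jacobiator a b (hv_scale c (hv_e p)) (hv_scale d (hv_e q)) (hv_scale e (hv_e u))
            = hv_scale (c * d * e) (hv_jacobiator a b (hv_e p) (hv_e q) (hv_e u))"
          by (simp only: hv_bracket_scale_left hv_bracket_scale_right hv.scale_right_distrib
              hv.scale_scale mult_ac)
        also have "\<dots> = 0"
          by (simp only: hv_jacobi_basis hv.scale_zero_right)
        finally show ?case
          by (simp only: sgl[of p c, symmetric] sgl[of q d, symmetric] sgl[of u e, symmetric])
      qed
    qed
  qed
qed

theorem lie_algebra_hv: "lie_algebra hv_scale (hv_bracket a b)"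
proof -
  have "hv_bracket a b x x = 0" for x
  proof (rule poly_mapping_eqI)
    fix p
    have "Poly_Mapping.lookup (hv_bracket a b x x) p = - Poly_Mapping.lookup (hv_bracket a b x x) p"
      by (subst hv_bracket_swap) simp
    then show "Poly_Mapping.lookup (hv_bracket a b x x) p = Poly_Mapping.lookup 0 p" by simp
  qed
  then show ?thesis
    by unfold_locales
      (use hv_jacobi in \<open>auto simp: hv_bracket_add_left hv_bracket_add_right
         hv_bracket_scale_left hv_bracket_scale_right\<close>)
qed

end

theory Submission
  imports Defs
begin

text \<open>A free module of rank one is \<open>\<complex>[t]\<close> with \<open>L_{0,0}\<close> acting as multiplication by \<open>t\<close>. The brackets
  with \<open>L_{0,0}\<close> then express \<open>L_{i,m} f\<close> and \<open>H_{i,m} f\<close> through shifted derivatives of \<open>f\<close> and the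
  polynomials \<open>L_{i,m} 1\<close> and \<open>H_{i,m} 1\<close>, so only these have to be found. Comparing leading
  coefficients in \<open>[L_{i,0}, L_{j,0}]\<close> shows that all \<open>L_{i,0} 1\<close> have degree 1, and comparing them in
  \<open>[L_{-1,0}, L_{1,1}]\<close> that \<open>L_{0,1} 1\<close> has degree at most 1; the brackets determine the remaining
  \<open>L_{i,m} 1\<close>. If \<open>H_{j,0} 1\<close> is nonzero of degree \<open>d\<close> and \<open>a + j \<noteq> 0\<close>, comparing the relations for
  \<open>[L_{i,0}, H_{j,1}]\<close> and \<open>[L_{i,1}, H_{j,0}]\<close> gives \<open>b = - d\<close> or \<open>(b, d) = (1, 0)\<close>, and
  \<open>[H_{j,0}, H_{i+j,0}] = 0\<close> excludes \<open>d > 0\<close>. The brackets \<open>[L_{i,m}, H_{j,0}]\<close> give the other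
  \<open>H_{i,m} 1\<close>. The target need not be checked to be a module: its action is the transported one.\<close>

section \<open>Shifts and derivatives of polynomials\<close>

abbreviation shift :: "complex \<Rightarrow> complex poly \<Rightarrow> complex poly" where
  "shift c f \<equiv> pcompose f [:- c, 1:]"

lemma poly_ext: "(\<And>x. poly p x = poly q x) \<Longrightarrow> p = q" for p q :: "complex poly"
  by (simp add: poly_eq_poly_eq_iff[symmetric] fun_eq_iff)

lemma poly_shift: "poly (shift c f) x = poly f (x - c)"
  by (simp add: poly_pcompose)

lemma degree_shift: "degree (shift c f) = degree f"
  by (simp add: degree_pcompose)

section \<open>Leading coefficients of shifted polynomials\<close>

lemma coeff_shift_degree: "degree f \<le> n \<Longrightarrow> coeff (shift c f) n = coeff f n"
proof (induction n arbitrary: f)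
  case 0
  then obtain u where "f = [:u:]" by (metis degree_eq_zeroE le_zero_eq)
  then show ?case by simp
next
  case (Suc n)
  obtain u q where f: "f = pCons u q" by (cases f)
  with Suc.prems have q: "degree q \<le> n" by (auto split: if_splits)
  then have "coeff (shift c q) (Suc n) = 0"
    by (intro coeff_eq_0) (simp add: degree_shift)
  then show ?case using Suc.IH[OF q] by (simp add: f pcompose_pCons)
qed

text \<open>By Taylor \<open>f(t - c) = f - c f' + ...\<close>, and the omitted terms have degree
  below \<open>n\<close> or vanish.\<close>

lemma coeff_shift_subleading:
  "degree f \<le> Suc n \<Longrightarrow>
    coeff (shift c f) n = coeff f n - c * of_nat (Suc n) * coeff f (Suc n)"
proof (induction n arbitrary: f)
  case 0
  obtain u q where f: "f = pCons u q" by (cases f)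
  with 0 have "degree q \<le> 0" by (auto split: if_splits)
  then obtain v where "q = [:v:]" by (metis degree_eq_zeroE le_zero_eq)
  then show ?case by (simp add: f pcompose_pCons)
next
  case (Suc n)
  obtain u q where f: "f = pCons u q" by (cases f)
  with Suc.prems have q: "degree q \<le> Suc n" by (auto split: if_splits)
  have "coeff (shift c q) (Suc n) = coeff q (Suc n)"
    by (rule coeff_shift_degree[OF q])
  then show ?case using Suc.IH[OF q] by (simp add: f pcompose_pCons algebra_simps)
qed

lemma poly_degree_le_1:
  fixes p :: "complex poly"
  assumes "degree p \<le> 1"
  obtains u v where "p = [:u, v:]"
proof
  show "p = [:coeff p 0, coeff p 1:]"
    using assms by (intro poly_eqI) (auto simp: coeff_pCons coeff_eq_0 split: nat.splits)
qed

lemma degree_shift_diff: "degree f \<le> n \<Longrightarrow> degree (shift c f - f) \<le> n - 1"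
proof -
  assume f: "degree f \<le> n"
  show ?thesis
  proof (rule degree_le, intro allI impI)
    fix i assume "n - 1 < i"
    then have "degree f \<le> i" using f by linarith
    then show "coeff (shift c f - f) i = 0"
      by (simp add: coeff_shift_degree)
  qed
qed

text \<open>The leading part of \<open>shift c f - f\<close> is that of \<open>- c f'\<close>, at
  index \<open>n - 1\<close>; multiplying by the variable moves it to index
  \<open>n\<close>.\<close>

lemma coeff_linear_mult_shift_diff:
  assumes "degree f \<le> n"
  shows "coeff ([:e, 1:] * (shift c f - f)) n = - c * of_nat n * coeff f n"
proof (cases n)
  case 0
  with assms obtain u where "f = [:u:]" by (metis degree_eq_zeroE le_zero_eq)
  then show ?thesis by (simp add: 0)
next
  case (Suc m)
  then show ?thesis
    using assms coeff_shift_degree[OF assms] coeff_shift_subleading[of f m c]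
    by (simp add: coeff_pCons algebra_simps)
qed

lemma coeff_mult_top:
  fixes p q :: "'a::comm_semiring_0 poly"
  assumes "degree p \<le> m" "degree q \<le> n"
  shows "coeff (p * q) (m + n) = coeff p m * coeff q n"
proof -
  have "coeff (p * q) (m + n) = (\<Sum>i\<le>m + n. coeff p i * coeff q (m + n - i))"
    by (rule coeff_mult)
  also have "\<dots> = (\<Sum>i\<le>m + n. if i = m then coeff p m * coeff q n else 0)"
  proof (intro sum.cong refl)
    fix i
    show "coeff p i * coeff q (m + n - i) = (if i = m then coeff p m * coeff q n else 0)"
      using assms by (cases i m rule: linorder_cases) (auto simp: coeff_eq_0)
  qed
  finally show ?thesis by simp
qed

text \<open>The polynomial is the value at 1 of the commutator of
  \<open>f \<mapsto> p * shift c f\<close> and \<open>f \<mapsto> q * shift d f\<close>. The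
  products \<open>p * q\<close> cancel, which lowers the degree by one and leaves the first-order
  terms of the two shifts.\<close>

lemma coeff_twisted_commutator:
  assumes "degree p \<le> m" "degree q \<le> n" "m + n = Suc k"
  shows "coeff (p * shift c q - q * shift d p) k
    = (of_nat m * d - of_nat n * c) * coeff p m * coeff q n"
proof -
  have *: "coeff (p * (shift c q - q)) k = - of_nat n * c * coeff p m * coeff q n"
    if "degree p \<le> m" "degree q \<le> n" "m + n = Suc k" for p q :: "complex poly" and m n c
  proof (cases n)
    case 0
    with that obtain u where "q = [:u:]" by (metis degree_eq_zeroE le_zero_eq)
    then show ?thesis by (simp add: 0)
  next
    case (Suc n')
    with that have k: "k = m + n'" by simp
    have "degree (shift c q - q) \<le> n'" using degree_shift_diff[OF that(2)] Suc by simp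
    from coeff_mult_top[OF that(1) this] show ?thesis
      using that(2) by (simp add: k Suc coeff_shift_subleading algebra_simps)
  qed
  have "p * shift c q - q * shift d p = p * (shift c q - q) - q * (shift d p - p)"
    by (simp add: algebra_simps)
  then show ?thesis
    using *[OF assms, of c] *[OF assms(2,1), of d] assms(3) by (simp add: algebra_simps)
qed

section \<open>Expansion of an operator in shifted derivatives\<close>

lemma deriv_shift_0: "deriv_shift 0 c f = shift c f"
  by (simp add: deriv_shift_def)

text \<open>Leibniz rule for \<open>t f\<close>: derivatives of \<open>t\<close> beyond the first
  vanish. For \<open>s = 0\<close> the truncated index \<open>s - 1\<close> carries the factor
  0.\<close>

lemma higher_pderiv_mult_var:
  "(pderiv ^^ s) (pCons 0 f) = pCons 0 ((pderiv ^^ s) f) + smult (of_nat s) ((pderiv ^^ (s - 1)) f)"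
  for f :: "complex poly"
proof (induction s)
  case (Suc s)
  then show ?case
    by (cases s) (auto intro!: poly_ext simp: pderiv_add pderiv_smult pderiv_pCons algebra_simps)
qed simp

lemma deriv_shift_mult_var:
  "deriv_shift s c (pCons 0 f) =
    [:- c, 1:] * deriv_shift s c f + smult (of_nat s) (deriv_shift (s - 1) c f)"
  by (simp add: deriv_shift_def higher_pderiv_mult_var pcompose_add pcompose_smult pcompose_pCons)

lemma deriv_shift_add: "deriv_shift s c (f + g) = deriv_shift s c f + deriv_shift s c g"
  by (simp add: deriv_shift_def higher_pderiv_add pcompose_add)

lemma deriv_shift_const: "deriv_shift s c [:u:] = (if s = 0 then [:u:] else 0)"
proof -
  have "(pderiv ^^ s) [:u:] = (if s = 0 then [:u:] else 0)"
    by (induction s) auto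
  then show ?thesis by (simp add: deriv_shift_def)
qed

lemma smult_sum_right: "smult k (\<Sum>x\<in>A. f x) = (\<Sum>x\<in>A. smult k (f x))"
  by (induction A rule: infinite_finite_induct) (auto simp: smult_add_right)

text \<open>The hypothesis on \<open>T\<close> is the bracket relation between \<open>L_{0,0}\<close>, acting as multiplication by
  the variable, and a family of basis elements \<open>L_{i,m}\<close> or \<open>H_{i,m}\<close> with \<open>i\<close> fixed.\<close>

lemma intertwiner_expansion:
  fixes T :: "nat \<Rightarrow> complex poly \<Rightarrow> complex poly"
  assumes add: "\<And>m f g. T m (f + g) = T m f + T m g"
    and smult: "\<And>m k f. T m (smult k f) = smult k (T m f)"
    and var: "\<And>m f. T m (pCons 0 f) = [:- c, 1:] * T m f + smult (of_nat m) (T (m - 1) f)"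
  shows "T m f = (\<Sum>s = 0..m. smult (of_nat (m choose s)) (T (m - s) 1 * deriv_shift s c f))"
proof (induction f arbitrary: m)
  case 0
  have "T m 0 = 0" using smult[of m 0 0] by simp
  moreover have "deriv_shift s c 0 = 0" for s using deriv_shift_const[of s c 0] by simp
  ultimately show ?case by simp
next
  case (pCons u f)
  \<comment> \<open>The sum obeys the same rules as \<open>T\<close>, including the one for
    \<open>pCons 0 f\<close>, and agrees with \<open>T\<close> on constants; so the two agree by
    induction on the coefficients of \<open>f\<close>.\<close>
  let ?S = "\<lambda>m f. \<Sum>s = 0..m. smult (of_nat (m choose s)) (T (m - s) 1 * deriv_shift s c f)"
  have S_add: "?S m (f + g) = ?S m f + ?S m g" for f g
    by (simp add: deriv_shift_add algebra_simps smult_add_right sum.distrib)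
  have S_const: "?S m [:u:] = smult u (T m 1)"
  proof -
    have "?S m [:u:] = (\<Sum>s = 0..m. if s = 0 then smult u (T m 1) else 0)"
      by (intro sum.cong) (auto simp: deriv_shift_const)
    then show ?thesis by simp
  qed
  have S_var: "?S m (pCons 0 f) = [:- c, 1:] * ?S m f + smult (of_nat m) (?S (m - 1) f)"
  proof -
    have "?S m (pCons 0 f) = (\<Sum>s = 0..m. smult (of_nat (m choose s))
          (T (m - s) 1 * ([:- c, 1:] * deriv_shift s c f)))
        + (\<Sum>s = 0..m. smult (of_nat ((m choose s) * s)) (T (m - s) 1 * deriv_shift (s - 1) c f))"
      by (simp add: deriv_shift_mult_var distrib_left smult_add_right sum.distrib
          del: mult_pCons_left)
    moreover have "(\<Sum>s = 0..m. smult (of_nat (m choose s))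
          (T (m - s) 1 * ([:- c, 1:] * deriv_shift s c f))) = [:- c, 1:] * ?S m f"
      unfolding sum_distrib_left
      by (intro sum.cong refl)
        (simp only: mult_smult_right mult_smult_left mult.left_commute[of _ "[:- c, 1:]"])
    moreover have "(\<Sum>s = 0..m. smult (of_nat ((m choose s) * s))
          (T (m - s) 1 * deriv_shift (s - 1) c f)) = smult (of_nat m) (?S (m - 1) f)"
    proof (cases m)
      case (Suc k)
      \<comment> \<open>The term \<open>s = 0\<close> has factor 0, so the index moves by one; then
        \<open>(s + 1) (k + 1 choose s + 1) = (k + 1) (k choose s)\<close> applies.\<close>
      have "(\<Sum>s = 0..m. smult (of_nat ((m choose s) * s)) (T (m - s) 1 * deriv_shift (s - 1) c f))
          = (\<Sum>s = 0..k. smult (of_nat ((Suc k choose Suc s) * Suc s))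
              (T (k - s) 1 * deriv_shift s c f))"
        unfolding Suc by (subst sum.atLeast0_atMost_Suc_shift) (simp add: algebra_simps del: binomial_Suc_Suc)
      also have "\<dots> = (\<Sum>s = 0..k. smult (of_nat (Suc k * (k choose s)))
              (T (k - s) 1 * deriv_shift s c f))"
        by (intro sum.cong refl)
          (metis Suc_times_binomial mult.commute)
      finally show ?thesis by (simp add: Suc smult_sum_right algebra_simps del: binomial_Suc_Suc)
    qed simp
    ultimately show ?thesis by simp
  qed
  have split: "pCons u f = [:u:] + pCons 0 f" by simp
  have "T m [:u:] = smult u (T m 1)" using smult[of m u 1] by simp
  then have "T m (pCons u f)
      = smult u (T m 1) + ([:- c, 1:] * ?S m f + smult (of_nat m) (?S (m - 1) f))"
    by (subst split) (simp only: add var pCons.IH[symmetric])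
  also have "\<dots> = ?S m (pCons u f)"
    by (subst split) (simp only: S_add S_const S_var)
  finally show ?case .
qed

section \<open>The action of the elements \<open>L_{i,m}\<close>\<close>

text \<open>\<open>E i m\<close> is the action of \<open>L_{i,m}\<close> on \<open>\<complex>[t]\<close>.\<close>

locale L_rank_one =
  fixes E :: "int \<Rightarrow> nat \<Rightarrow> complex poly \<Rightarrow> complex poly"
  assumes E_add: "E i m (f + g) = E i m f + E i m g"
    and E_smult: "E i m (smult k f) = smult k (E i m f)"
    and E_var: "E 0 0 f = pCons 0 f"
    and E_E: "E i m (E j n f) - E j n (E i m f) =
      smult (of_int j - of_int i) (E (i + j) (m + n) f)
      - smult (of_nat n - of_nat m) (E (i + j) (m + n - 1) f)"
begin

text \<open>This is \<open>[L_{0,0}, L_{i,m}] = i L_{i,m} - m L_{i,m-1}\<close>, in the form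
  required by \<open>intertwiner_expansion\<close>.\<close>

lemma E_pCons_0:
  "E i m (pCons 0 f) = [:- of_int i, 1:] * E i m f + smult (of_nat m) (E i (m - 1) f)"
  using E_E[of 0 0 i m f] by (simp add: E_var algebra_simps)

lemma E_expansion:
  "E i m f = (\<Sum>s = 0..m. smult (of_nat (m choose s)) (E i (m - s) 1 * deriv_shift s (of_int i) f))"
  by (rule intertwiner_expansion[OF E_add E_smult E_pCons_0])

lemma E_0_eq: "E i 0 f = E i 0 1 * shift (of_int i) f"
  by (subst E_expansion) (simp add: deriv_shift_0)

lemma E_linear:
  "E i m [:p, q:] = smult p (E i m 1)
    + smult q ([:- of_int i, 1:] * E i m 1 + smult (of_nat m) (E i (m - 1) 1))"
proof -
  have "[:p, q:] = smult p 1 + smult q (pCons 0 1)" by simp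
  then show ?thesis by (simp only: E_add E_smult E_pCons_0)
qed

section \<open>The polynomials \<open>L_{i,0} 1\<close>\<close>

lemma g_bracket:
  "E i 0 1 * shift (of_int i) (E j 0 1) - E j 0 1 * shift (of_int j) (E i 0 1)
    = smult (of_int (j - i)) (E (i + j) 0 1)"
  using E_E[of i 0 j 0 1] by (subst (asm) (1 2) E_0_eq) simp

lemma g_0: "E 0 0 1 = [:0, 1:]"
  by (simp add: E_var one_pCons)

text \<open>For \<open>j = - i\<close> the bracket equals \<open>- 2 i t\<close>. If
  \<open>d\<close> and \<open>e\<close> are the two degrees, its coefficient of index
  \<open>d + e - 1\<close> has the nonzero factor \<open>- (d + e) i\<close>; hence
  \<open>d + e - 1 = 1\<close>.\<close>

lemma g_opposite:
  assumes "i \<noteq> 0"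
  shows "E i 0 1 \<noteq> 0" and "degree (E i 0 1) + degree (E (- i) 0 1) = 2"
proof -
  let ?d = "degree (E i 0 1)" and ?e = "degree (E (- i) 0 1)"
  have br: "E i 0 1 * shift (of_int i) (E (- i) 0 1) - E (- i) 0 1 * shift (- of_int i) (E i 0 1)
      = [:0, - 2 * of_int i:]"
    using g_bracket[of i "- i"] by (simp add: g_0)
  show g: "E i 0 1 \<noteq> 0"
    using br assms by auto
  have g': "E (- i) 0 1 \<noteq> 0"
    using br assms by auto
  show "?d + ?e = 2"
  proof (cases "?d + ?e")
    case 0
    then obtain u v where "E i 0 1 = [:u:]" "E (- i) 0 1 = [:v:]"
      by (metis add_is_0 degree_eq_zeroE)
    then show ?thesis using br assms by simp
  next
    case (Suc k)
    have "coeff [:0, - 2 * of_int i:] k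
        = (of_nat ?d * (- of_int i) - of_nat ?e * of_int i)
          * lead_coeff (E i 0 1) * lead_coeff (E (- i) 0 1)"
      unfolding br[symmetric] by (rule coeff_twisted_commutator) (use Suc in auto)
    also have "\<dots> = - (of_nat (?d + ?e) * of_int i)
          * lead_coeff (E i 0 1) * lead_coeff (E (- i) 0 1)"
      by (simp add: algebra_simps)
    also have "\<dots> \<noteq> 0" unfolding Suc using g g' assms by (simp del: of_nat_Suc)
    finally have "k = 1" by (auto simp: coeff_pCons split: nat.splits)
    then show ?thesis using Suc by simp
  qed
qed

text \<open>By \<open>g_opposite\<close>, a constant \<open>L_{i,0} 1\<close> forces degree 2 at
  \<open>- i\<close>. The bracket for \<open>- i\<close> and \<open>2 i\<close> then has degree at
  least 1, although it is a multiple of \<open>L_{i,0} 1\<close>.\<close>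

lemma degree_g: "degree (E i 0 1) = 1"
proof -
  have "degree (E i 0 1) \<noteq> 0" if i: "i \<noteq> 0" for i
  proof
    assume d: "degree (E i 0 1) = 0"
    let ?e = "degree (E (2 * i) 0 1)"
    have nz: "E (- i) 0 1 \<noteq> 0" "E (2 * i) 0 1 \<noteq> 0"
      using g_opposite(1)[of "- i"] g_opposite(1)[of "2 * i"] i by auto
    have d': "degree (E (- i) 0 1) = 2"
      using g_opposite(2)[OF i] d by simp
    have "coeff (smult (of_int (2 * i - - i)) (E (- i + 2 * i) 0 1)) (Suc ?e)
        = (of_nat 2 * of_int (2 * i) - of_nat ?e * of_int (- i))
          * coeff (E (- i) 0 1) 2 * coeff (E (2 * i) 0 1) ?e"
      unfolding g_bracket[symmetric]
      by (rule coeff_twisted_commutator) (use d' in auto)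
    moreover have "coeff (E (- i + 2 * i) 0 1) (Suc ?e) = 0"
      using d by (simp add: coeff_eq_0)
    moreover have "of_nat 2 * of_int (2 * i) - of_nat ?e * of_int (- i)
        = (of_nat (4 + ?e) * of_int i :: complex)"
      by (simp add: algebra_simps)
    moreover have "of_nat (4 + ?e) * of_int i \<noteq> (0 :: complex)"
      using i by (simp del: of_nat_add)
    moreover have "coeff (E (- i) 0 1) 2 \<noteq> 0" "coeff (E (2 * i) 0 1) ?e \<noteq> 0"
      using nz d' by (metis leading_coeff_0_iff)+
    ultimately show False by simp
  qed
  from this[of i] this[of "- i"] g_opposite(2)[of i] show ?thesis
    by (cases "i = 0") (auto simp: g_0)
qed

text \<open>With \<open>L_{i,0} 1 = w i + l i * t\<close> the brackets become recursions for
  numbers, which determine all \<open>l i\<close> and \<open>w i\<close> from \<open>l 1\<close> and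
  \<open>w 1\<close>.\<close>

lemma ex_g:
  obtains lam \<alpha> where "lam \<noteq> 0" "\<And>i. E i 0 1 = smult (lam powi i) [:- (of_int i * \<alpha>), 1:]"
proof -
  define l where "l i = coeff (E i 0 1) 1" for i
  define w where "w i = coeff (E i 0 1) 0" for i
  have g: "E i 0 1 = [:w i, l i:]" for i
    using degree_g[of i] unfolding l_def w_def
    by (intro poly_eqI) (auto simp: coeff_pCons coeff_eq_0 split: nat.splits)
  have l_nz: "l i \<noteq> 0" for i
    using degree_g[of i] by (auto simp: g)
  have br: "of_int (j - i) * l (i + j) = of_int (j - i) * (l i * l j)"
    "of_int (j - i) * w (i + j) = of_int j * (l i * w j) - of_int i * (w i * l j)" for i j
    using g_bracket[of i j] by (auto simp: g pcompose_pCons algebra_simps)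
  have l_add: "l (i + j) = l i * l j" if "i \<noteq> j" for i j
    using br(1)[where i = i and j = j] that by (auto simp del: of_int_diff)
  have lw_0: "l 0 = 1" "w 0 = 0"
    using g_0 by (auto simp: g)
  have l_m1: "l 1 * l (- 1) = 1"
    using l_add[of 1 "- 1"] lw_0 by simp
  define lam where "lam = l 1"
  define \<alpha> where "\<alpha> = - w 1 / l 1"
  have lam: "lam \<noteq> 0" using l_nz by (simp add: lam_def)
  have w_1: "w 1 = - \<alpha> * lam" using l_nz[of 1] by (simp add: \<alpha>_def lam_def)
  have l_m1': "l (- 1) = inverse lam" using l_m1 lam by (simp add: lam_def field_simps)
  \<comment> \<open>The induction pairs \<open>n + 1\<close> with \<open>- 1\<close>, which always
    differ, as \<open>l_add\<close> requires; \<open>1\<close> and \<open>n\<close> would coincide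
    for \<open>n = 1\<close>.\<close>
  have l_nat: "l (int n) = lam ^ n" for n
  proof (induction n)
    case (Suc n)
    have "l (int (Suc n)) * l (- 1) = l (int n)"
      using l_add[of "int (Suc n)" "- 1"] by simp
    then show ?case using Suc lam by (simp add: l_m1' field_simps)
  qed (simp add: lw_0)
  have w_m1: "w (- 1) = \<alpha> / lam"
    using br(2)[where i = 1 and j = "- 1"] lam by (simp add: lw_0 w_1 l_m1' lam_def[symmetric] field_simps)
  have w_nat: "w (int n) = - (of_nat n * \<alpha> * lam ^ n)" for n
  proof (induction n)
    case (Suc n)
    have "- (of_nat n + 2) * w (int n)
        = - (l (int (Suc n)) * w (- 1)) - of_nat (Suc n) * (w (int (Suc n)) * l (- 1))"
      using br(2)[where i = "int (Suc n)" and j = "- 1"] by (simp add: algebra_simps)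
    then have "of_nat (Suc n) * w (int (Suc n)) = of_nat (Suc n) * (- (of_nat (Suc n) * \<alpha> * lam ^ Suc n))"
      using lam by (simp add: Suc.IH l_nat[of "Suc n", simplified] w_m1 l_m1' field_simps)
    then show ?case by (simp only: mult_cancel_left of_nat_eq_0_iff) simp
  qed (simp add: lw_0)
  have neg: "l (- i) = inverse (l i)" "w (- i) = - w i * inverse (l i) ^ 2" if "i \<noteq> 0" for i
  proof -
    show *: "l (- i) = inverse (l i)"
      using l_add[of i "- i"] that lw_0 l_nz[of i] by (simp add: field_simps)
    have "of_int i * (l i * w (- i) + w i * inverse (l i)) = 0"
      using br(2)[where i = i and j = "- i"] by (simp add: lw_0 * algebra_simps)
    then have "l i * w (- i) + w i * inverse (l i) = 0"
      using that by simp
    then show "w (- i) = - w i * inverse (l i) ^ 2"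
      using l_nz[of i] by (simp add: field_simps power2_eq_square add_eq_0_iff)
  qed
  have "E i 0 1 = smult (lam powi i) [:- (of_int i * \<alpha>), 1:]" for i
  proof (cases "0 \<le> i")
    case True
    then obtain n where "i = int n" by (metis nonneg_int_cases)
    then show ?thesis by (simp add: g l_nat w_nat)
  next
    case False
    then obtain n where i: "i = - int n" and "n \<noteq> 0"
      by (metis int_cases2 linorder_linear neg_0_le_iff_le of_nat_0 of_nat_0_le_iff minus_zero)
    then show ?thesis using lam neg[of "int n"]
      by (simp add: g l_nat w_nat power_int_minus power2_eq_square field_simps)
  qed
  with lam show ?thesis by (rule that)
qed

text \<open>The brackets of \<open>L_{1,0}\<close> with \<open>L_{0,1}\<close> and of
  \<open>L_{-1,0}\<close> with \<open>L_{1,1}\<close> express \<open>L_{1,1} 1\<close> and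
  \<open>L_{0,1} 1\<close> through each other. This bounds the degree of \<open>L_{0,1} 1\<close>
  and yields \<open>\<beta>\<close>; induction on \<open>m\<close> gives the rest.\<close>

lemma ex_E_1:
  obtains lam \<alpha> \<beta> where "lam \<noteq> 0" "\<And>i m. E i m 1 = smult (lam powi i)
    (smult (\<beta> ^ m) [:- (of_int i * \<alpha>), 1:] + [:of_nat m * \<alpha> * \<beta> ^ (m - 1):])"
proof -
  note One_nat_def [simp del]
  obtain lam \<alpha> where lam: "lam \<noteq> 0"
    and g: "\<And>i. E i 0 1 = smult (lam powi i) [:- (of_int i * \<alpha>), 1:]"
    by (rule ex_g) blast
  define p where "p = E 0 1 1"
  have E_1: "E i 1 f = E i 1 1 * shift (of_int i) f + E i 0 1 * deriv_shift 1 (of_int i) f" for i f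
    by (subst E_expansion) (simp add: deriv_shift_0 One_nat_def)
  have E_1_linear: "E 0 1 f = p * f + pCons 0 (pderiv f)" for f
    using E_1[of 0 f] by (simp add: p_def g_0 deriv_shift_def funpow.simps One_nat_def)
  define G where "G = smult (1 / lam) (E 1 1 1)"
  have E11: "E 1 1 1 = smult lam G" using lam by (simp add: G_def)
  have G: "G = [:- \<alpha>, 1:] * (p - shift 1 p) + [:\<alpha>:]"
  proof -
    have "smult lam G = E 0 1 (E 1 0 1) - E 1 0 p - E 1 0 1"
      using E_E[of 1 0 0 1 1] by (simp add: p_def E11 algebra_simps)
    moreover have "E 1 0 p = smult lam [:- \<alpha>, 1:] * shift 1 p"
      by (subst E_0_eq) (simp add: g)
    moreover have "E 0 1 (E 1 0 1) = p * smult lam [:- \<alpha>, 1:] + smult lam [:0, 1:]"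
      by (simp add: E_1_linear g pderiv_pCons)
    ultimately have "smult lam G = p * smult lam [:- \<alpha>, 1:] + smult lam [:0, 1:]
        - smult lam [:- \<alpha>, 1:] * shift 1 p - E 1 0 1"
      by (simp only:)
    also have "\<dots> = smult lam ([:- \<alpha>, 1:] * (p - shift 1 p) + [:\<alpha>:])"
      by (intro poly_ext) (simp add: g algebra_simps)
    finally show ?thesis by (rule smult_cancel[OF lam])
  qed
  have p: "smult 2 p = [:\<alpha>, 1:] * (shift (- 1) G - G) + G + [:\<alpha>:]"
  proof -
    have "E (- 1) 0 (E 1 1 1) - E 1 1 (E (- 1) 0 1) = smult 2 p - [:0, 1:]"
      using E_E[of "- 1" 0 1 1 1] by (simp add: p_def g_0)
    moreover have "E (- 1) 0 (E 1 1 1) = [:\<alpha>, 1:] * shift (- 1) G"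
      by (subst E_0_eq) (use lam in \<open>intro poly_ext; simp add: g E11 poly_pcompose power_int_minus field_simps\<close>)
    moreover have "E 1 1 (E (- 1) 0 1) = [:\<alpha> - 1, 1:] * G + [:- \<alpha>, 1:]"
      unfolding g using lam
      by (intro poly_ext) (simp add: E_linear g E11 power_int_minus field_simps)
    ultimately have "smult 2 p
        = [:\<alpha>, 1:] * shift (- 1) G - ([:\<alpha> - 1, 1:] * G + [:- \<alpha>, 1:]) + [:0, 1:]" by simp
    also have "\<dots> = [:\<alpha>, 1:] * (shift (- 1) G - G) + G + [:\<alpha>:]"
      by (intro poly_ext) (simp add: poly_pcompose algebra_simps)
    finally show ?thesis .
  qed
  have "degree p \<le> 1"
  proof (rule ccontr)
    assume "\<not> degree p \<le> 1"
    then have "2 \<le> degree p" by simp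
    then obtain k where k: "degree p = 2 + k" using le_Suc_ex by blast
    then have "p \<noteq> 0" by auto
    let ?d = "degree p"
    \<comment> \<open>At indices from 2 on, the added constants are invisible. The top coefficient
      of \<open>p\<close> gains the factor \<open>?d\<close> on the way to \<open>G\<close> and
      \<open>?d + 1\<close> on the way back to \<open>2 p\<close>, so
      \<open>?d * ?d + ?d = 2\<close>.\<close>
    have coeff_G: "coeff G n = of_nat n * coeff p n" if "?d \<le> n" for n
    proof -
      from that k have "2 \<le> n" by simp
      then obtain r where r: "n = Suc (Suc r)" using le_Suc_ex[of 2 n] by auto
      have "coeff G n = - coeff ([:- \<alpha>, 1:] * (shift 1 p - p)) n"
        unfolding G by (simp add: r algebra_simps)
      also have "\<dots> = of_nat n * coeff p n"
        using that by (subst coeff_linear_mult_shift_diff) auto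
      finally show ?thesis .
    qed
    have deg_G: "degree G \<le> ?d"
      by (rule degree_le) (simp add: coeff_G coeff_eq_0)
    have "2 * coeff p ?d = coeff ([:\<alpha>, 1:] * (shift (- 1) G - G)) ?d + coeff G ?d"
      using arg_cong[OF p, of "\<lambda>q. coeff q ?d"] by (simp add: k)
    also have "\<dots> = of_nat ?d * (of_nat ?d * coeff p ?d) + of_nat ?d * coeff p ?d"
      using coeff_linear_mult_shift_diff[OF deg_G, of \<alpha> "- 1"] by (simp add: coeff_G)
    finally have "of_nat (?d * ?d + ?d) * coeff p ?d = of_nat 2 * coeff p ?d"
      by (simp add: algebra_simps)
    moreover have "coeff p ?d \<noteq> 0" using \<open>p \<noteq> 0\<close> by simp
    ultimately have "?d * ?d + ?d = 2" by (simp only: mult_cancel_right of_nat_eq_iff) simp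
    then show False by (simp add: k)
  qed
  then obtain c \<beta> where c: "p = [:c, \<beta>:]"
    using poly_degree_le_1 by blast
  have G': "G = [:\<alpha> - \<alpha> * \<beta>, \<beta>:]"
    by (simp add: G c pcompose_pCons algebra_simps)
  \<comment> \<open>Comparison of constant terms; the slope \<open>\<beta>\<close> remains
    free.\<close>
  have "c = \<alpha>"
    using p unfolding G' c by (simp add: pcompose_pCons)
  with c have p': "p = [:\<alpha>, \<beta>:]" by simp
  define e where "e i m = smult (lam powi i)
    (smult (\<beta> ^ m) [:- (of_int i * \<alpha>), 1:] + [:of_nat m * \<alpha> * \<beta> ^ (m - 1):])" for i m
  have "E i m 1 = e i m" for i m
  proof (induction m arbitrary: i rule: less_induct)
    case (less m)
    show ?case
    proof (cases m)
      case 0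
      then show ?thesis by (simp add: g e_def)
    next
      case (Suc k)
      have IH: "E i k 1 = e i k" for i
        by (rule less.IH) (simp add: Suc)
      have IH': "smult (of_nat k) (E i (k - 1) 1) = smult (of_nat k) (e i (k - 1))" for i
        by (cases k) (simp_all add: less.IH Suc)
      \<comment> \<open>The bracket with \<open>L_{0,1}\<close> raises the second index, with factor
        \<open>i\<close>; the closed form \<open>e\<close> satisfies the same relation.\<close>
      have nz: "E i (Suc k) 1 = e i (Suc k)" if "i \<noteq> 0" for i
      proof -
        have "E 0 1 (E i k 1) - E i k p
            = smult (of_int i) (E i (Suc k) 1) - smult (of_nat k - 1) (E i k 1)"
          using E_E[of 0 1 i k 1] by (simp add: p_def plus_1_eq_Suc)
        moreover have "E 0 1 (e i k) - E i k p
            = smult (of_int i) (e i (Suc k)) - smult (of_nat k - 1) (e i k)"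
          unfolding p' E_linear IH IH' unfolding E_1_linear p'
          by (intro poly_ext, cases k; cases "k - 1")
            (simp_all add: e_def pderiv_add pderiv_smult pderiv_pCons algebra_simps)
        ultimately have "smult (of_int i) (E i (Suc k) 1) = smult (of_int i) (e i (Suc k))"
          by (simp add: IH)
        then show ?thesis
          by (rule smult_cancel[rotated]) (simp add: that)
      qed
      \<comment> \<open>At index 0 that factor vanishes; \<open>[L_{-1,0}, L_{1,k+1}]\<close>
        reaches it with factor 2.\<close>
      have z: "E 0 (Suc k) 1 = e 0 (Suc k)"
      proof -
        have E_m1: "E (- 1) 0 1 = [:\<alpha> / lam, 1 / lam:]"
          using lam by (simp add: g power_int_minus field_simps)
        have "E (- 1) 0 (E 1 (Suc k) 1) - E 1 (Suc k) (E (- 1) 0 1)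
            = smult 2 (E 0 (Suc k) 1) - smult (of_nat (Suc k)) (E 0 k 1)"
          using E_E[of "- 1" 0 1 "Suc k" 1] by simp
        moreover have "E (- 1) 0 (e 1 (Suc k)) - E 1 (Suc k) (E (- 1) 0 1)
            = smult 2 (e 0 (Suc k)) - smult (of_nat (Suc k)) (e 0 k)"
          unfolding E_0_eq[of "- 1" "e 1 (Suc k)"] E_m1 E_linear nz[OF one_neq_zero] diff_Suc_1 IH
          using lam by (intro poly_ext, cases k)
            (simp_all add: e_def poly_pcompose field_simps)
        ultimately have "smult 2 (E 0 (Suc k) 1) = smult 2 (e 0 (Suc k))"
          by (simp add: nz IH)
        then show ?thesis
          by (rule smult_cancel[rotated]) simp
      qed
      show ?thesis using nz[of i] z by (cases "i = 0") (simp_all add: Suc)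
    qed
  qed
  with lam show ?thesis by (intro that[of lam \<beta> \<alpha>]) (simp_all only: e_def simp_thms)
qed

end

section \<open>The action of the elements \<open>H_{i,m}\<close>\<close>

text \<open>\<open>F i m\<close> is the action of \<open>H_{i,m}\<close> on \<open>\<complex>[t]\<close>.\<close>

locale HV_rank_one = L_rank_one E
  for E :: "int \<Rightarrow> nat \<Rightarrow> complex poly \<Rightarrow> complex poly" +
  fixes a b lam \<alpha> \<beta> :: complex and F :: "int \<Rightarrow> nat \<Rightarrow> complex poly \<Rightarrow> complex poly"
  assumes Re_a: "0 \<le> Re a" "Re a < 1"
    and lam: "lam \<noteq> 0"
    and E_1: "E i m 1 = smult (lam powi i)
      (smult (\<beta> ^ m) [:- (of_int i * \<alpha>), 1:] + [:of_nat m * \<alpha> * \<beta> ^ (m - 1):])"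
    and F_add: "F i m (f + g) = F i m f + F i m g"
    and F_smult: "F i m (smult k f) = smult k (F i m f)"
    and E_F: "E i m (F j n f) - F j n (E i m f) =
      smult (a + of_int j + b * of_int i) (F (i + j) (m + n) f)
      - smult (of_nat n + b * of_nat m) (F (i + j) (m + n - 1) f)"
    and F_F: "F i m (F j n f) = F j n (F i m f)"
begin

lemma E_omega: "E i m f = omega_basis a b lam \<alpha> \<beta> \<gamma> (L i m) f"
  unfolding omega_basis.simps
  by (subst E_expansion, intro sum.cong refl poly_ext) (simp add: E_1 algebra_simps)

text \<open>If \<open>a = - j\<close>, then \<open>a\<close> is an integer in the strip
  \<open>0 \<le> Re a < 1\<close>, hence 0.\<close>

lemma a_plus_nz: "a + of_int j \<noteq> 0" if "a \<noteq> 0 \<or> j \<noteq> 0"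
proof
  assume "a + of_int j = 0"
  then have a: "a = - of_int j" by (simp add: add_eq_0_iff2)
  with Re_a have "0 \<le> - j" "- j < 1" by auto
  then have "j = 0" by simp
  with a that show False by simp
qed

lemma F_pCons_0:
  "F j n (pCons 0 f) = [:- (a + of_int j), 1:] * F j n f + smult (of_nat n) (F j (n - 1) f)"
  using E_F[of 0 0 j n f] by (simp add: E_var smult_diff_left smult_add_left algebra_simps)

lemma F_expansion: "F j n f =
  (\<Sum>s = 0..n. smult (of_nat (n choose s)) (F j (n - s) 1 * deriv_shift s (a + of_int j) f))"
  by (rule intertwiner_expansion[OF F_add F_smult F_pCons_0])

lemma F_0_eq: "F j 0 f = F j 0 1 * shift (a + of_int j) f"
  by (subst F_expansion) (simp add: deriv_shift_0)

lemma F_linear: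
  "F i m [:p, q:] = smult p (F i m 1)
    + smult q ([:- (a + of_int i), 1:] * F i m 1 + smult (of_nat m) (F i (m - 1) 1))"
proof -
  have "[:p, q:] = smult p 1 + smult q (pCons 0 1)" by simp
  then show ?thesis by (simp only: F_add F_smult F_pCons_0)
qed

section \<open>Relations for the polynomials \<open>H_{j,0} 1\<close>\<close>

lemma E_0: "E i 0 f = smult (lam powi i) ([:- (of_int i * \<alpha>), 1:] * shift (of_int i) f)"
  by (subst E_0_eq) (intro poly_ext, simp add: E_1 algebra_simps)

lemma E_Suc_0: "E i (Suc 0) f = smult (lam powi i)
   (([:\<alpha> - \<beta> * (of_int i * \<alpha>), \<beta>:]) * shift (of_int i) f
    + [:- (of_int i * \<alpha>), 1:] * shift (of_int i) (pderiv f))"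
  by (subst E_expansion) (intro poly_ext, simp add: E_1 deriv_shift_def algebra_simps)

text \<open>The bracket \<open>[L_{i,0}, H_{j,0}]\<close> at 1. It determines
  \<open>H_{i+j,0} 1\<close> from \<open>H_{j,0} 1\<close> unless the factor on the left is
  0.\<close>

lemma h_transport:
  "smult (a + of_int j + b * of_int i) (F (i + j) 0 1) = smult (lam powi i)
    ([:- (of_int i * \<alpha>), 1:] * (shift (of_int i) (F j 0 1) - F j 0 1)
     + smult (a + of_int j) (F j 0 1))"
proof -
  have "smult (a + of_int j + b * of_int i) (F (i + j) 0 1)
      = E i 0 (F j 0 1) - F j 0 (E i 0 1)"
    using E_F[of i 0 j 0 1] by simp
  also have "\<dots> = smult (lam powi i)
    ([:- (of_int i * \<alpha>), 1:] * (shift (of_int i) (F j 0 1) - F j 0 1)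
     + smult (a + of_int j) (F j 0 1))"
    by (subst F_0_eq[of _ "E i 0 1"]) (intro poly_ext, simp add: E_0 poly_pcompose algebra_simps)
  finally show ?thesis .
qed

text \<open>Subtracting \<open>\<beta>\<close> times \<open>H_{j,0} 1\<close>, the value that
  \<open>H_{j,1} 1\<close> takes for \<open>b = 0\<close>, removes \<open>\<beta>\<close> from the
  relations.\<close>

definition h1_defect :: "int \<Rightarrow> complex poly" where
  "h1_defect j = F j 1 1 - smult \<beta> (F j 0 1)"

text \<open>The bracket \<open>[L_{0,1}, H_{j,0}]\<close> at 1. The right side multiplies the
  coefficient of index \<open>n\<close> of \<open>H_{j,0} 1\<close> by \<open>n + b\<close>.\<close>

lemma h1_defect_eq:
  "smult (a + of_int j) (h1_defect j) = pCons 0 (pderiv (F j 0 1)) + smult b (F j 0 1)"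
proof -
  have "smult (a + of_int j) (F j 1 1) - smult b (F j 0 1) = E 0 1 (F j 0 1) - F j 0 (E 0 1 1)"
    using E_F[of 0 1 j 0 1] by simp
  also have "\<dots> = smult (\<beta> * (a + of_int j)) (F j 0 1) + pCons 0 (pderiv (F j 0 1))"
    by (subst F_0_eq[of _ "E 0 1 1"])
      (intro poly_ext, simp add: E_Suc_0 poly_pcompose algebra_simps)
  finally have "smult (a + of_int j) (F j 1 1)
      = smult (\<beta> * (a + of_int j)) (F j 0 1) + pCons 0 (pderiv (F j 0 1)) + smult b (F j 0 1)"
    by (simp add: algebra_simps)
  then show ?thesis by (simp add: h1_defect_def smult_diff_right algebra_simps)
qed

text \<open>The difference of the relations for \<open>[L_{i,0}, H_{j,1}]\<close> and \<open>[L_{i,1}, H_{j,0}]\<close>, in which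
  \<open>H_{i+j,1}\<close> cancels.\<close>

lemma h1_defect_transport:
  "smult (1 - b) (F (i + j) 0 1) = smult (lam powi i)
    (smult \<alpha> (shift (of_int i) (F j 0 1) - F j 0 1)
     + [:- (of_int i * \<alpha>), 1:] * shift (of_int i) (pderiv (F j 0 1))
     - [:- (of_int i * \<alpha>), 1:] * (shift (of_int i) (h1_defect j) - h1_defect j)
     - smult (a + of_int j) (h1_defect j) + F j 0 1)"
proof -
  let ?h = "F j 0 1"
  have F1: "F j 1 1 = h1_defect j + smult \<beta> ?h" by (simp add: h1_defect_def)
  have "smult (1 - b) (F (i + j) 0 1)
      = (E i 1 ?h - F j 0 (E i 1 1)) - (E i 0 (F j 1 1) - F j 1 (E i 0 1))"
    using E_F[of i 1 j 0 1] E_F[of i 0 j 1 1] by (simp add: smult_diff_left)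
  also have "\<dots> = smult (lam powi i)
    (smult \<alpha> (shift (of_int i) ?h - ?h)
     + [:- (of_int i * \<alpha>), 1:] * shift (of_int i) (pderiv ?h)
     - [:- (of_int i * \<alpha>), 1:] * (shift (of_int i) (h1_defect j) - h1_defect j)
     - smult (a + of_int j) (h1_defect j) + ?h)"
  proof -
    have e0: "F j 1 (E i 0 1) = smult (lam powi i)
        ([:- (of_int i * \<alpha>) - (a + of_int j), 1:] * F j 1 1 + ?h)"
      by (subst E_1) (intro poly_ext, simp add: F_linear algebra_simps del: mult_pCons_left)
    show ?thesis
      by (subst F_0_eq[of _ "E i 1 1"], subst e0)
        (intro poly_ext, simp add: F1[simplified] E_0 E_Suc_0 poly_pcompose algebra_simps)
  qed
  finally show ?thesis .
qed

text \<open>\<open>h_transport\<close> and \<open>h1_defect_transport\<close> give two equations for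
  the coefficient \<open>x\<close> of index \<open>d\<close> of \<open>H_{i+j,0} 1\<close> in terms
  of the leading coefficient \<open>c\<close> of \<open>H_{j,0} 1\<close>. Eliminating
  \<open>x\<close> and cancelling \<open>c\<close> leaves a condition on \<open>b\<close> and
  \<open>d\<close> for each \<open>i\<close>.\<close>

lemma coeff_h_relation:
  fixes j :: int
  defines "s \<equiv> a + of_int j" and "d \<equiv> degree (F j 0 1)"
  assumes s: "s \<noteq> 0" and h: "F j 0 1 \<noteq> 0"
  shows "s * (1 - b) * (s - of_int i * of_nat d)
    = (s + b * of_int i) * (s * (1 - b) + of_int i * of_nat d * (of_nat d + b))"
    and "(s + b * of_int i) * coeff (F (i + j) 0 1) d
    = lam powi i * (s - of_int i * of_nat d) * coeff (F j 0 1) d"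
    and "s + b * of_int i \<noteq> 0 \<Longrightarrow> degree (F (i + j) 0 1) \<le> d"
proof -
  define h where "h = F j 0 1"
  define c where "c = coeff h d"
  define x where "x = coeff (F (i + j) 0 1) d"
  define l where "l = lam powi i"
  have l: "l \<noteq> 0" using lam by (simp add: l_def)
  have c: "c \<noteq> 0" using assms(4) by (simp add: c_def h_def d_def)
  have deg_h: "degree h \<le> d" by (simp add: h_def d_def)
  have top: "coeff (pCons 0 (pderiv h)) n = of_nat n * coeff h n" for n
    by (cases n) (auto simp: coeff_pderiv)
  have defect': "s * coeff (h1_defect j) n = (of_nat n + b) * coeff h n" for n
    using arg_cong[OF h1_defect_eq[of j], of "\<lambda>q. coeff q n"] top[of n]
    by (simp add: h_def s_def algebra_simps)
  have deg_defect: "degree (h1_defect j) \<le> d"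
  proof (rule degree_le, intro allI impI)
    fix n assume "d < n"
    then show "coeff (h1_defect j) n = 0" using defect'[of n] s deg_h by (simp add: coeff_eq_0)
  qed
  have shift_h: "coeff (shift (of_int i) h) n = coeff h n" if "d \<le> n" for n
    using that deg_h by (intro coeff_shift_degree) simp
  have tr: "coeff ([:- (of_int i * \<alpha>), 1:] * (shift (of_int i) h - h)) n
      = - of_int i * of_nat n * coeff h n" if "d \<le> n" for n
    using that deg_h by (intro coeff_linear_mult_shift_diff) simp
  have tr': "(s + b * of_int i) * coeff (F (i + j) 0 1) n
      = l * (s - of_int i * of_nat n) * coeff h n" if "d \<le> n" for n
    using arg_cong[OF h_transport[of j i], of "\<lambda>q. coeff q n"]
    unfolding h_def[symmetric] l_def[symmetric] s_def[symmetric] coeff_smult coeff_add tr[OF that]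
    by (simp add: algebra_simps)
  show eq1: "(s + b * of_int i) * coeff (F (i + j) 0 1) d
    = lam powi i * (s - of_int i * of_nat d) * coeff (F j 0 1) d"
    using tr'[of d] by (simp add: l_def h_def)
  show "degree (F (i + j) 0 1) \<le> d" if nz: "s + b * of_int i \<noteq> 0"
  proof (rule degree_le, intro allI impI)
    fix n assume "d < n"
    then show "coeff (F (i + j) 0 1) n = 0" using tr'[of n] nz deg_h by (simp add: coeff_eq_0)
  qed
  have sp: "coeff ([:- (of_int i * \<alpha>), 1:] * shift (of_int i) (pderiv h)) d = of_nat d * c"
  proof (cases d)
    case 0
    then have "pderiv h = 0" using deg_h by (simp add: pderiv_eq_0_iff)
    then show ?thesis by (simp add: 0)
  next
    case (Suc r)
    have "degree (pderiv h) \<le> r" using deg_h Suc by (simp add: degree_pderiv)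
    moreover have "coeff h (Suc (Suc r)) = 0" using deg_h Suc by (simp add: coeff_eq_0)
    ultimately show ?thesis
      by (simp add: Suc c_def coeff_shift_degree coeff_pderiv)
  qed
  have "(1 - b) * x = l * (of_nat d * c + of_int i * of_nat d * coeff (h1_defect j) d
      - s * coeff (h1_defect j) d + c)"
    using arg_cong[OF h1_defect_transport[of i j], of "\<lambda>q. coeff q d"]
    unfolding h_def[symmetric] l_def[symmetric] s_def[symmetric] coeff_smult coeff_add coeff_diff
      sp shift_h[OF order_refl] coeff_linear_mult_shift_diff[OF deg_defect] x_def[symmetric]
    by (simp add: c_def)
  then have eq2: "s * (1 - b) * x = l * (s * (1 - b) + of_int i * of_nat d * (of_nat d + b)) * c"
    using defect'[of d] unfolding c_def[symmetric] by algebra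
  have "(s + b * of_int i) * x = l * (s - of_int i * of_nat d) * c"
    using tr'[of d] by (simp add: x_def c_def)
  with eq2 have "l * c * (s * (1 - b) * (s - of_int i * of_nat d))
    = l * c * ((s + b * of_int i) * (s * (1 - b) + of_int i * of_nat d * (of_nat d + b)))"
    by algebra
  then show "s * (1 - b) * (s - of_int i * of_nat d)
    = (s + b * of_int i) * (s * (1 - b) + of_int i * of_nat d * (of_nat d + b))"
    using l c by simp
qed

lemma h_const:
  assumes s: "a + of_int j \<noteq> 0" and h: "F j 0 1 \<noteq> 0"
  shows "degree (F j 0 1) = 0" "b = 0 \<or> b = 1"
proof -
  define s where "s = a + of_int j"
  define d where "d = degree (F j 0 1)"
  note rel = coeff_h_relation[OF assms, folded s_def d_def]
  have s_nz: "s \<noteq> 0" using s by (simp add: s_def)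
  define D where "D = (of_nat d :: complex)"
  have rel_1: "s * (1 - b) * (s - D) = (s + b) * (s * (1 - b) + D * (D + b))"
    using rel(1)[of 1] by (simp add: D_def)
  have rel_m1: "s * (1 - b) * (s + D) = (s - b) * (s * (1 - b) - D * (D + b))"
    using rel(1)[of "- 1"] by (simp add: D_def)
  \<comment> \<open>Sum and difference of the relations for \<open>i = 1\<close> and
    \<open>i = - 1\<close> isolate their even and odd parts in \<open>i\<close>.\<close>
  have "2 * (b * (D * (D + b))) = 0"
    using rel_1 rel_m1 by algebra
  moreover have "2 * (s * ((D + b) * (1 + D - b))) = 0"
    using rel_1 rel_m1 by algebra
  ultimately have eqs: "b = 0 \<or> d = 0 \<or> of_nat d + b = 0"
    "of_nat d + b = 0 \<or> 1 + of_nat d - b = 0"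
    using s_nz by (auto simp: D_def)
  have d0: "d = 0" if db: "of_nat d + b = 0"
  proof (rule ccontr)
    assume d: "d \<noteq> 0"
    have b: "b = - of_nat d" using db by (simp add: add_eq_0_iff)
    obtain i :: int where i: "i \<noteq> 0" "s + b * of_int i \<noteq> 0"
    proof (cases "s + b = 0")
      case True
      then show ?thesis using that[of "- 1"] s_nz by (auto simp: add_eq_0_iff)
    next
      case False
      then show ?thesis using that[of 1] by simp
    qed
    define p where "p = F j 0 1"
    define q where "q = F (i + j) 0 1"
    have deg: "degree p \<le> d" "degree q \<le> d"
      using rel(3)[OF i(2)] by (auto simp: d_def p_def q_def)
    \<comment> \<open>With \<open>b = - d\<close> the factors \<open>s + b i\<close> and
      \<open>s - i d\<close> coincide, so \<open>q\<close> also has degree \<open>d\<close>.\<close>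
    have "(s + b * of_int i) * coeff q d = (s + b * of_int i) * (lam powi i * coeff p d)"
      using rel(2)[of i] by (simp add: b p_def q_def algebra_simps)
    then have cq: "coeff q d = lam powi i * coeff p d" using i(2) by simp
    have cp: "coeff p d \<noteq> 0" using h by (simp add: p_def d_def)
    obtain r where r: "d + d = Suc r" using d by (metis add_is_0 not0_implies_Suc)
    have "p * shift (a + of_int j) q - q * shift (a + of_int (i + j)) p = 0"
      using F_F[of j 0 "i + j" 0 1] by (subst (asm) (1 2) F_0_eq) (simp add: p_def q_def)
    \<comment> \<open>As the degrees are equal, the top coefficient contains \<open>d\<close> times
      the difference \<open>i\<close> of the two shifts.\<close>
    then have "(of_nat d * (a + of_int (i + j)) - of_nat d * (a + of_int j))
        * coeff p d * coeff q d = 0"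
      using coeff_twisted_commutator[OF deg r, of "a + of_int j" "a + of_int (i + j)"] by simp
    then have "of_nat d * of_int i * coeff p d * coeff q d = 0"
      by (simp add: algebra_simps)
    then show False using d i(1) cp cq lam by simp
  qed
  have "d = 0 \<and> (b = 0 \<or> b = 1)"
  proof (cases "of_nat d + b = 0")
    case True
    with d0[OF True] show ?thesis by simp
  next
    case False
    with eqs have b: "b = of_nat (Suc d)" by (simp add: algebra_simps)
    have "b \<noteq> 0" unfolding b by (simp del: of_nat_Suc)
    with eqs False have "d = 0" by simp
    with b show ?thesis by simp
  qed
  then show "degree (F j 0 1) = 0" "b = 0 \<or> b = 1" by (auto simp: d_def)
qed

section \<open>The polynomials \<open>H_{i,m} 1\<close>\<close>

lemma ex_h_const:
  assumes "a + of_int j \<noteq> 0"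
  obtains u where "F j 0 1 = [:u:]"
proof (cases "F j 0 1 = 0")
  case True
  then show ?thesis using that[of 0] by simp
next
  case False
  from h_const(1)[OF assms this] show ?thesis using that by (metis degree_eq_zeroE)
qed

text \<open>At 1, \<open>[L_{i,m}, H_{j,0}]\<close> is \<open>u\<close> times the difference of
  \<open>L_{i,m} 1\<close> and its shift by \<open>a + j\<close>. This is constant, as
  \<open>L_{i,m} 1\<close> has degree at most 1, with slope
  \<open>lam powi i * \<beta> ^ m\<close>.\<close>

lemma F_transport:
  assumes "F j 0 1 = [:u:]"
  shows "smult (a + of_int j + b * of_int i) (F (i + j) m 1)
    - smult (b * of_nat m) (F (i + j) (m - 1) 1)
    = [:(a + of_int j) * lam powi i * \<beta> ^ m * u:]"
proof -
  have "smult (a + of_int j + b * of_int i) (F (i + j) m 1)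
    - smult (b * of_nat m) (F (i + j) (m - 1) 1) = E i m (F j 0 1) - F j 0 (E i m 1)"
    using E_F[of i m j 0 1] by simp
  also have "E i m (F j 0 1) = smult u (E i m 1)"
    using E_smult[of i m u 1] by (simp add: assms)
  also have "smult u (E i m 1) - F j 0 (E i m 1)
      = [:(a + of_int j) * lam powi i * \<beta> ^ m * u:]"
  proof (rule poly_ext)
    fix x
    have ev: "poly (E i m 1) y = lam powi i * (\<beta> ^ m * (y - of_int i * \<alpha>)
        + of_nat m * \<alpha> * \<beta> ^ (m - 1))" for y
      by (simp add: E_1 algebra_simps)
    have "u * (l * (B * (x - t) + B')) - u * (l * (B * (x - s - t) + B')) = s * l * B * u"
      for l s t B B' :: complex by algebra
    then show "poly (smult u (E i m 1) - F j 0 (E i m 1)) x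
        = poly [:(a + of_int j) * lam powi i * \<beta> ^ m * u:] x"
      by (subst F_0_eq) (simp only: poly_diff poly_smult poly_mult poly_shift assms ev poly_pCons
          poly_0 mult_zero_right add_0_right)
  qed
  finally show ?thesis .
qed

text \<open>\<open>F_transport\<close> starts from index 1, because \<open>a + 1 \<noteq> 0\<close>
  even when \<open>a = 0\<close>; \<open>\<gamma> = u / lam\<close> corrects the offset in
  \<open>lam powi (i - 1)\<close>.\<close>

lemma F_1_b_0:
  assumes "b = 0"
  obtains \<gamma> where "\<And>i m. F i m 1 = [:lam powi i * \<beta> ^ m * \<gamma>:]"
proof -
  have nz: "a + 1 \<noteq> 0" using a_plus_nz[of 1] by simp
  obtain u where u: "F 1 0 1 = [:u:]" using ex_h_const[of 1] nz by auto
  have "F i m 1 = [:lam powi i * \<beta> ^ m * (u / lam):]" for i m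
  proof -
    have "smult (a + 1) (F i m 1) = smult (a + 1) [:lam powi (i - 1) * \<beta> ^ m * u:]"
      using F_transport[OF u, of "i - 1" m] assms by (simp add: mult_ac)
    then have "F i m 1 = [:lam powi (i - 1) * \<beta> ^ m * u:]" by (rule smult_cancel[OF nz])
    then show ?thesis using lam by (simp add: power_int_diff)
  qed
  then show ?thesis by (rule that)
qed

text \<open>From index 0, \<open>F_transport\<close> is a first-order recursion in \<open>m\<close>
  with factor \<open>a + i\<close>; unrolling it gives the sum, with
  \<open>\<gamma> = u\<close>.\<close>

lemma F_1_b_1:
  assumes "b = 1" "a \<noteq> 0"
  obtains \<gamma> where "\<And>i m. F i m 1 = [:\<Sum>l = 0..m. fact m / fact (m - l)
    * (a * lam powi i * \<beta> ^ (m - l) * \<gamma> / (a + of_int i) ^ (l + 1)):]"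
proof -
  obtain u where u: "F 0 0 1 = [:u:]" using ex_h_const[of 0] assms by auto
  have "F i m 1 = [:\<Sum>l = 0..m. fact m / fact (m - l)
      * (a * lam powi i * \<beta> ^ (m - l) * u / (a + of_int i) ^ (l + 1)):]" for i m
  proof (induction m)
    case 0
    have nz: "a + of_int i \<noteq> 0" using a_plus_nz assms by simp
    have "smult (a + of_int i) (F i 0 1) = smult (a + of_int i) [:a * lam powi i * u / (a + of_int i):]"
      using F_transport[OF u, of i 0] nz assms by simp
    then show ?case by (simp add: smult_cancel[OF nz])
  next
    case (Suc m)
    let ?t = "a + of_int i" and ?S = "\<lambda>m. \<Sum>l = 0..m. fact m / fact (m - l)
      * (a * lam powi i * \<beta> ^ (m - l) * u / (a + of_int i) ^ (l + 1))"
    have nz: "?t \<noteq> 0" using a_plus_nz assms by simp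
    have "smult ?t (F i (Suc m) 1) = [:of_nat (Suc m) * ?S m + a * lam powi i * \<beta> ^ Suc m * u:]"
      using F_transport[OF u, of i "Suc m"] assms Suc.IH
      by (simp add: algebra_simps diff_eq_eq del: of_nat_Suc)
    also have "of_nat (Suc m) * ?S m + a * lam powi i * \<beta> ^ Suc m * u = ?t * ?S (Suc m)"
    proof -
      \<comment> \<open>The term \<open>l = 0\<close> comes from the inhomogeneous part; the others
        are \<open>(m + 1) / (a + i)\<close> times the sum for \<open>m\<close>.\<close>
      have "?S (Suc m) = a * lam powi i * \<beta> ^ Suc m * u / ?t
         + (\<Sum>l = 0..m. fact (Suc m) / fact (m - l)
            * (a * lam powi i * \<beta> ^ (m - l) * u / (a + of_int i) ^ (l + 2)))"
        by (subst sum.atLeast0_atMost_Suc_shift) (simp del: of_nat_Suc)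
      also have "(\<Sum>l = 0..m. fact (Suc m) / fact (m - l)
            * (a * lam powi i * \<beta> ^ (m - l) * u / (a + of_int i) ^ (l + 2)))
          = of_nat (Suc m) * ?S m / ?t"
        unfolding sum_distrib_left sum_divide_distrib
        by (intro sum.cong refl) (simp add: fact_Suc mult_ac del: of_nat_Suc)
      finally show ?thesis
        by (simp only: distrib_left times_divide_eq_right nonzero_mult_div_cancel_left[OF nz] add.commute)
    qed
    finally have "smult ?t (F i (Suc m) 1) = smult ?t [:?S (Suc m):]"
      by simp
    then show ?case by (rule smult_cancel[OF nz])
  qed
  then show ?thesis by (rule that)
qed

lemma h_zero:
  assumes b: "b \<noteq> 0" and ba: "b = 1 \<longrightarrow> a = 0"
  shows "F j 0 1 = 0"
proof (cases "b = 1")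
  case False
  have h0: "F j 0 1 = 0" if "a + of_int j \<noteq> 0" for j
    using h_const(2)[OF that] b False by blast
  show ?thesis
  proof (cases "a + of_int j = 0")
    case True
    then have a: "a = - of_int j" by (simp add: add_eq_0_iff2)
    \<comment> \<open>The exceptional index is reached from \<open>j - 1\<close>, with factor
      \<open>b - 1\<close>.\<close>
    have "F (j - 1) 0 1 = 0" by (rule h0) (simp add: a)
    then show ?thesis using h_transport[of "j - 1" 1] False by (simp add: a)
  qed (rule h0)
next
  case True
  with ba have a: "a = 0" by simp
  show ?thesis
  proof (cases "j = 0")
    case j: True
    have "coeff (F 0 0 1) n = 0" for n
    proof -
      \<comment> \<open>Here \<open>h1_defect_eq\<close> reads \<open>t h' + h = 0\<close>.\<close>
      have "coeff (pCons 0 (pderiv (F 0 0 1)) + F 0 0 1) n = 0"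
        using h1_defect_eq[of 0] by (simp add: a True)
      then have "of_nat (Suc n) * coeff (F 0 0 1) n = 0"
        by (cases n) (auto simp: coeff_pderiv algebra_simps)
      then show ?thesis by (simp only: mult_eq_0_iff of_nat_eq_0_iff) simp
    qed
    then show ?thesis by (simp add: j poly_eq_iff)
  next
    case j: False
    then obtain u where u: "F j 0 1 = [:u:]" using ex_h_const[of j] a by auto
    \<comment> \<open>Transport to index 0 has factor 0 on the left, which forces
      \<open>u = 0\<close>.\<close>
    then show ?thesis using F_transport[OF u, of "- j" 0] j lam by (simp add: a True)
  qed
qed

lemma F_1_zero:
  assumes b: "b \<noteq> 0" and ba: "b = 1 \<longrightarrow> a = 0"
  shows "F i m 1 = 0"
proof -
  have h: "F j 0 1 = [:0:]" for j using h_zero[OF assms] by simp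
  have step: "F (r + j) m 1 = 0"
    if nz: "a + of_int j + b * of_int r \<noteq> 0" for r j m
  proof (induction m)
    case 0
    show ?case using h by simp
  next
    case (Suc m)
    then show ?case using F_transport[OF h, of j r "Suc m"] nz by simp
  qed
  show ?thesis
  proof (cases "b = 1")
    case False
    show ?thesis
    proof (cases "a + of_int i = 0")
      case True
      \<comment> \<open>This splitting of \<open>i\<close> has factor \<open>b - 1\<close>.\<close>
      then have "a + of_int (i - 1) + b * of_int 1 \<noteq> 0"
        using False by (simp add: add_eq_0_iff2)
      from step[OF this] show ?thesis by simp
    next
      case False
      then show ?thesis using step[of i 0] by simp
    qed
  next
    case True
    with ba have a: "a = 0" by simp
    have nz: "F j m 1 = 0" if "j \<noteq> 0" for j m
      using step[of j 0] that by (simp add: a)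
    have zero: "E 1 1 0 = 0" using E_smult[of 1 1 0 0] by simp
    \<comment> \<open>Every splitting of index 0 now has factor 0;
      \<open>[L_{1,1}, H_{-1,m}] = - (m + 1) H_{0,m}\<close> reaches it instead.\<close>
    have "E 1 1 (F (- 1) m 1) - F (- 1) m (E 1 1 1) = - smult (of_nat (Suc m)) (F 0 m 1)"
      using E_F[of 1 1 "- 1" m 1] by (simp add: a True add.commute)
    moreover obtain p q where "E 1 1 1 = [:p, q:]" by (simp add: E_1)
    ultimately have "smult (of_nat (Suc m)) (F 0 m 1) = 0"
      using zero by (simp add: F_linear nz)
    then have "F 0 m 1 = 0" by (simp only: smult_eq_0_iff of_nat_eq_0_iff) simp
    with nz show ?thesis by (cases "i = 0") auto
  qed
qed

lemma ex_F_omega: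
  obtains \<gamma> where "\<And>i m f. F i m f = omega_basis a b lam \<alpha> \<beta> \<gamma> (H i m) f"
proof -
  consider "b = 0" | "b = 1" "a \<noteq> 0" | "b \<noteq> 0" "b = 1 \<longrightarrow> a = 0" by blast
  then show ?thesis
  proof cases
    case 1
    then obtain \<gamma> where \<gamma>: "\<And>i m. F i m 1 = [:lam powi i * \<beta> ^ m * \<gamma>:]" by (rule F_1_b_0) blast
    show ?thesis
      by (rule that[of \<gamma>], subst F_expansion) (simp add: 1 \<gamma> mult_ac)
  next
    case 2
    then obtain \<gamma> where \<gamma>: "\<And>i m. F i m 1 = [:\<Sum>l = 0..m. fact m / fact (m - l)
      * (a * lam powi i * \<beta> ^ (m - l) * \<gamma> / (a + of_int i) ^ (l + 1)):]" by (rule F_1_b_1) blast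
    show ?thesis
      by (rule that[of \<gamma>], subst F_expansion)
        (simp add: 2 \<gamma> smult_sum[symmetric] sum_distrib_left mult_ac)
  next
    case 3
    then show ?thesis
      by (intro that[of 0], subst F_expansion) (auto simp: F_1_zero)
  qed
qed

end

section \<open>Reduction to polynomials\<close>

lemma vector_space_smult: "vector_space (smult :: complex \<Rightarrow> complex poly \<Rightarrow> complex poly)"
  by unfold_locales (auto simp: smult_add_right smult_add_left)

lemma poly_action_const: "poly_action scale T [:c:] v = scale c v"
  by (simp add: poly_action_def)

lemma poly_action_var:
  assumes "vector_space scale"
  shows "poly_action scale T [:0, 1:] v = T v"
proof -
  interpret vector_space scale by fact
  show ?thesis by (simp add: poly_action_def)
qed

text \<open>For a basis vector \<open>w\<close> take \<open>\<phi> p = p(T) w\<close>: spanning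
  makes it surjective, independence injective.\<close>

lemma free_of_rank_one_poly_action:
  fixes scale :: "'k::field \<Rightarrow> 'v::ab_group_add \<Rightarrow> 'v"
  assumes "vector_space scale" and free: "free_of_rank_one (poly_action scale T)"
  obtains \<phi> where "bij \<phi>" "\<And>p q. \<phi> (p + q) = \<phi> p + \<phi> q"
    "\<And>c p. \<phi> (smult c p) = scale c (\<phi> p)" "\<And>p. \<phi> (pCons 0 p) = T (\<phi> p)"
proof -
  from free interpret M: module "poly_action scale T" by (simp add: free_of_rank_one_def)
  from free obtain w where ind: "\<not> M.dependent {w}" and span: "M.span {w} = UNIV"
    by (auto simp: free_of_rank_one_def)
  define \<phi> where "\<phi> p = poly_action scale T p w" for p
  have "surj \<phi>" using span by (simp add: M.span_singleton \<phi>_def[abs_def])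
  have "p = q" if "\<phi> p = \<phi> q" for p q
  proof (rule ccontr)
    assume "p \<noteq> q"
    with that have "\<exists>v\<in>{w}. p - q \<noteq> 0"
      "(\<Sum>v\<in>{w}. poly_action scale T (p - q) v) = 0"
      by (auto simp: \<phi>_def M.scale_left_diff_distrib)
    then have "M.dependent {w}"
      unfolding M.dependent_explicit by (intro exI[of _ "{w}"] exI[of _ "\<lambda>_. p - q"]) simp
    with ind show False by simp
  qed
  then have "inj \<phi>" by (rule injI)
  show ?thesis
  proof (rule that)
    show "bij \<phi>" using \<open>inj \<phi>\<close> \<open>surj \<phi>\<close> by (rule bijI)
    show "\<phi> (p + q) = \<phi> p + \<phi> q" for p q by (simp add: \<phi>_def M.scale_left_distrib)
    show "\<phi> (smult c p) = scale c (\<phi> p)" for c p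
      using M.scale_scale[of "[:c:]" p w] by (simp add: \<phi>_def poly_action_const)
    show "\<phi> (pCons 0 p) = T (\<phi> p)" for p
      using M.scale_scale[of "[:0, 1:]" p w] by (simp add: \<phi>_def poly_action_var[OF assms(1)])
  qed
qed

section \<open>Identification of an action on polynomials, and transport to them\<close>

lemma hv_single: "Poly_Mapping.single p c = hv_scale c (hv_e p)"
  by (intro poly_mapping_eqI) (simp add: lookup_single when_def)

lemma lie_module_linear_polys:
  fixes act :: "hv \<Rightarrow> complex poly \<Rightarrow> complex poly"
  assumes "lie_module hv_scale (hv_bracket a b) smult act"
  shows "act (x - y) f = act x f - act y f"
    and "act (Poly_Mapping.single p c) f = smult c (act (hv_e p) f)"
    and "act x (f + g) = act x f + act x g"
    and "act x (smult c f) = smult c (act x f)"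
    and "act 0 f = 0"
    and "act (x + y) f = act x f + act y f"
proof -
  interpret lie_module hv_scale "hv_bracket a b" smult act by fact
  interpret l: Vector_Spaces.linear hv_scale smult "\<lambda>x. act x f" by (rule act_linear_left)
  interpret r: Vector_Spaces.linear smult smult "act x" by (rule act_linear_right)
  show "act (x - y) f = act x f - act y f" by (rule l.diff)
  show "act (Poly_Mapping.single p c) f = smult c (act (hv_e p) f)"
    by (subst hv_single) (rule l.scale)
  show "act x (f + g) = act x f + act x g" by (rule r.add)
  show "act x (smult c f) = smult c (act x f)" by (rule r.scale)
  show "act 0 f = 0" by (rule l.zero)
  show "act (x + y) f = act x f + act y f" by (rule l.add)
qed

lemma lie_module_polys_eq_omega:
  assumes "0 \<le> Re a" "Re a < 1"
    and lie: "lie_module hv_scale (hv_bracket a b) smult act"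
    and var: "\<And>f. act (hv_e (L 0 0)) f = pCons 0 f"
  obtains lam \<alpha> \<beta> \<gamma> where "lam \<noteq> 0" "act = omega a b lam \<alpha> \<beta> \<gamma>"
proof -
  note lin = lie_module_linear_polys[OF lie]
  define E where "E i m = act (hv_e (L i m))" for i m
  define F where "F i m = act (hv_e (H i m))" for i m
  have act_L: "act (Poly_Mapping.single (L i m) c) f = smult c (E i m f)"
    and act_H: "act (Poly_Mapping.single (H i m) c) f = smult c (F i m f)" for i m c f
    unfolding E_def F_def by (rule lin(2))+
  note lin' = lin(1,3-6) act_L act_H
  have br: "act (hv_e p) (act (hv_e q) f) - act (hv_e q) (act (hv_e p) f)
      = act (hv_bracket_basis a b p q) f" for p q f
    using lie_module.act_bracket[OF lie, of "hv_e p" "hv_e q" f]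
    by (simp add: hv_bracket_single)
  interpret L_rank_one E
  proof unfold_locales
    show "E i m (f + g) = E i m f + E i m g" "E i m (smult k f) = smult k (E i m f)"
      "E 0 0 f = pCons 0 f" for i m f g k
      by (simp_all only: E_def lin(3,4) var)
    show "E i m (E j n f) - E j n (E i m f) = smult (of_int j - of_int i) (E (i + j) (m + n) f)
        - smult (of_nat n - of_nat m) (E (i + j) (m + n - 1) f)" for i m j n f
      using br[of "L i m" "L j n" f] by (simp add: lin')
  qed
  obtain lam \<alpha> \<beta> where lam: "lam \<noteq> 0" and E_1: "\<And>i m. E i m 1 = smult (lam powi i)
    (smult (\<beta> ^ m) [:- (of_int i * \<alpha>), 1:] + [:of_nat m * \<alpha> * \<beta> ^ (m - 1):])"
    by (rule ex_E_1) blast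
  interpret HV_rank_one E a b lam \<alpha> \<beta> F
  proof unfold_locales
    show "F i m (f + g) = F i m f + F i m g" "F i m (smult k f) = smult k (F i m f)" for i m f g k
      by (simp_all only: F_def lin(3,4))
    show "E i m (F j n f) - F j n (E i m f)
        = smult (a + of_int j + b * of_int i) (F (i + j) (m + n) f)
        - smult (of_nat n + b * of_nat m) (F (i + j) (m + n - 1) f)" for i m j n f
      using br[of "L i m" "H j n" f] by (simp add: lin')
    show "F i m (F j n f) = F j n (F i m f)" for i m j n f
      using br[of "H i m" "H j n" f] by (simp add: lin')
  qed (fact assms(1,2) lam E_1)+
  obtain \<gamma> where F: "\<And>i m f. F i m f = omega_basis a b lam \<alpha> \<beta> \<gamma> (H i m) f"
    by (rule ex_F_omega) blast
  have basis: "act (hv_e p) f = omega_basis a b lam \<alpha> \<beta> \<gamma> p f" for p f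
    using E_omega[of _ _ f \<gamma>] F by (cases p) (simp_all only: E_def F_def)
  have "act x f = omega a b lam \<alpha> \<beta> \<gamma> x f" for x f
  proof -
    interpret o: Vector_Spaces.linear hv_scale smult "\<lambda>x. omega a b lam \<alpha> \<beta> \<gamma> x f"
      unfolding omega_def by (rule linear_lin_ext[OF vector_space_smult])
    show ?thesis
    proof (induction x rule: hv_induct)
      case (single p c)
      show ?case
        by (simp only: lin(2)[of p c] basis omega_def lin_ext_single[OF vector_space_smult])
    qed (simp_all add: lin(5,6) o.add)
  qed
  with lam show ?thesis by (intro that[of lam \<alpha> \<beta> \<gamma>]) auto
qed

text \<open>Conjugation by a linear bijection preserves the module axioms. \<open>\<phi>\<close>
  leads from the new space to the old one, as \<open>free_of_rank_one_poly_action\<close> supplies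
  it, so the isomorphism is \<open>inv \<phi>\<close>.\<close>

lemma lie_module_transport:
  assumes V: "lie_module s br sV actV" and W: "vector_space sW"
    and \<phi>: "bij \<phi>" "\<And>v w. \<phi> (v + w) = \<phi> v + \<phi> w" "\<And>c v. \<phi> (sW c v) = sV c (\<phi> v)"
  defines "actW \<equiv> \<lambda>x v. inv \<phi> (actV x (\<phi> v))"
  shows "lie_module_isomorphism s br sV actV sW actW (inv \<phi>)"
proof -
  interpret V: lie_module s br sV actV by fact
  interpret W: vector_space sW by fact
  have \<phi>_inv: "\<phi> (inv \<phi> v) = v" for v using \<phi>(1) by (simp add: bij_is_surj surj_f_inv_f)
  have inv_\<phi>: "inv \<phi> (\<phi> v) = v" for v using \<phi>(1) by (simp add: bij_is_inj inv_f_f)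
  have inv_add: "inv \<phi> (v + w) = inv \<phi> v + inv \<phi> w" for v w
    by (metis \<phi>(2) \<phi>_inv inv_\<phi>)
  have inv_scale: "inv \<phi> (sV c v) = sW c (inv \<phi> v)" for c v
    by (metis \<phi>(3) \<phi>_inv inv_\<phi>)
  have inv: "Vector_Spaces.linear sV sW (inv \<phi>)"
    by unfold_locales (auto simp: inv_add inv_scale)
  interpret inv: Vector_Spaces.linear sV sW "inv \<phi>" by (rule inv)
  interpret l: Vector_Spaces.linear s sV "\<lambda>x. actV x v" for v by (rule V.act_linear_left)
  interpret r: Vector_Spaces.linear sV sV "actV x" for x by (rule V.act_linear_right)
  show ?thesis
    by unfold_locales
      (auto simp: actW_def l.add l.scale r.add r.scale \<phi> inv_add inv_scale V.act_bracket
        inv.diff \<phi>_inv intro!: bij_imp_bij_inv)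
qed

theorem theorem3p3:
  fixes a b :: complex
    and scale :: "complex \<Rightarrow> 'v::ab_group_add \<Rightarrow> 'v"
    and act :: "hv \<Rightarrow> 'v \<Rightarrow> 'v"
  assumes "0 \<le> Re a" and "Re a < 1"
    and "lie_module hv_scale (hv_bracket a b) scale act"
    and "free_of_rank_one (poly_action scale (act (Poly_Mapping.single (L 0 0) 1)))"
  shows "\<exists>lam \<alpha> \<beta> \<gamma>. lam \<noteq> 0 \<and>
    lie_module_isomorphic hv_scale (hv_bracket a b) scale act smult (omega a b lam \<alpha> \<beta> \<gamma>)"
proof -
  interpret V: lie_module hv_scale "hv_bracket a b" scale act by (rule assms(3))
  obtain \<phi> :: "complex poly \<Rightarrow> 'v" where \<phi>: "bij \<phi>" "\<And>p q. \<phi> (p + q) = \<phi> p + \<phi> q"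
    "\<And>c p. \<phi> (smult c p) = scale c (\<phi> p)" "\<And>p. \<phi> (pCons 0 p) = act (hv_e (L 0 0)) (\<phi> p)"
    by (rule free_of_rank_one_poly_action[OF V.V.vector_space_axioms assms(4)]) (rule that)
  define actP where "actP x f = inv \<phi> (act x (\<phi> f))" for x f
  have iso: "lie_module_isomorphism hv_scale (hv_bracket a b) scale act smult actP (inv \<phi>)"
    unfolding actP_def[abs_def]
    using assms(3) vector_space_smult \<phi>(1-3) by (rule lie_module_transport)
  then interpret iso: lie_module_isomorphism hv_scale "hv_bracket a b" scale act smult actP "inv \<phi>" .
  have "actP (hv_e (L 0 0)) f = pCons 0 f" for f
    using \<phi>(1) by (simp add: actP_def \<phi>(4)[symmetric] bij_is_inj)
  then obtain lam \<alpha> \<beta> \<gamma> where "lam \<noteq> 0" "actP = omega a b lam \<alpha> \<beta> \<gamma>"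
    by (rule lie_module_polys_eq_omega[OF assms(1,2) iso.W.lie_module_axioms]) (rule that)
  with iso show ?thesis unfolding lie_module_isomorphic_def by blast
qed

end
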